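(* For every finite monoid presentation $\langle \mathscr{A} \mid \mathscr{R} \rangle$ satisfying $C(4)$, there exists a two-tape Turing machine which solves the corresponding word problem (given words $u, v \in \mathscr{A}^*$, decide whether $u$ and $v$ represent the same element of the monoid presented) in time linear in the length of the shorter of the input words $u$ and $v$.
   Context: Words are elements of the free monoid $\mathscr{A}^*$, with empty word $\epsilon$. A relation word is a word occurring as one side of a relation of the presentation. A piece is a word which occurs as a factor in sides of two different relations, or as a factor of both sides of a relation, or in two different (possibly overlapping) places within one side of a relation; by convention $\epsilon$ is always a piece. The presentation satisfies $C(n)$, for $n$ a positive integer, if no relation word can be written as a product of strictly fewer than $n$ pieces ($\epsilon$ being the product of zero pieces). Model of computation: a Turing machine (depending on the fixed presentation) with two two-way-infinite read-write storage tapes, using a tape alphabet including the generators in $\mathscr{A}$ and a separator symbol $\#$. The input words are assumed to be initially encoded on one of the tapes in the form $\#u\#v\#p\#$, where $p$ is an auxiliary piece which is taken to be $\epsilon$ for the word problem. The presentation is fixed, so constants in the linear bound may depend on it. *)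

theory Defs
  imports Main "HOL-Library.Sublist"
begin

section \<open>Monoid presentations\<close>

definition finite_presentation :: "'a set \<Rightarrow> ('a list \<times> 'a list) set \<Rightarrow> bool" where
  "finite_presentation A R \<longleftrightarrow> finite A \<and> finite R \<and> R \<subseteq> lists A \<times> lists A"

text \<open>The least congruence on the free monoid \<open>lists A\<close> that contains \<open>R\<close>.\<close>

inductive_set presentation_cong ::
    "'a set \<Rightarrow> ('a list \<times> 'a list) set \<Rightarrow> ('a list \<times> 'a list) set"
  for A :: "'a set" and R :: "('a list \<times> 'a list) set" where
  rel: "(x, y) \<in> R \<Longrightarrow> (x, y) \<in> presentation_cong A R"
| refl: "w \<in> lists A \<Longrightarrow> (w, w) \<in> presentation_cong A R"
| sym: "(x, y) \<in> presentation_cong A R \<Longrightarrow> (y, x) \<in> presentation_cong A R"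
| trans: "\<lbrakk>(x, y) \<in> presentation_cong A R; (y, z) \<in> presentation_cong A R\<rbrakk>
    \<Longrightarrow> (x, z) \<in> presentation_cong A R"
| mult: "\<lbrakk>(x, x') \<in> presentation_cong A R; (y, y') \<in> presentation_cong A R\<rbrakk>
    \<Longrightarrow> (x @ y, x' @ y') \<in> presentation_cong A R"

lemma equiv_presentation_cong:
  assumes "finite_presentation A R"
  shows "equiv (lists A) (presentation_cong A R)"
proof (rule equivI)
  have "x \<in> lists A \<and> y \<in> lists A" if "(x, y) \<in> presentation_cong A R" for x y
    using that
  proof induction
    case (rel x y)
    then show ?case using assms unfolding finite_presentation_def by blast
  qed auto
  then show "presentation_cong A R \<subseteq> lists A \<times> lists A"
    by auto
  show "refl_on (lists A) (presentation_cong A R)"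
    by (auto simp: refl_on_def intro: presentation_cong.refl)
  show "sym_on UNIV (presentation_cong A R)"
    by (rule symI) (rule presentation_cong.sym)
  show "trans_on UNIV (presentation_cong A R)"
    by (rule transI) (rule presentation_cong.trans)
qed

text \<open>The element of the presented monoid \<open>lists A // presentation_cong A R\<close>
  represented by a word.\<close>

definition represented_element ::
    "'a set \<Rightarrow> ('a list \<times> 'a list) set \<Rightarrow> 'a list \<Rightarrow> 'a list set" where
  "represented_element A R w = presentation_cong A R `` {w}"

section \<open>Small overlap conditions\<close>

definition relation_words :: "('a list \<times> 'a list) set \<Rightarrow> 'a list set" where
  "relation_words R = fst ` R \<union> snd ` R"

definition factor_of_side :: "'a list \<Rightarrow> 'a list \<times> 'a list \<Rightarrow> bool" where
  "factor_of_side p r \<longleftrightarrow> sublist p (fst r) \<or> sublist p (snd r)"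

text \<open>Different occurrences of \<open>p\<close> in \<open>w\<close> are
  distinguished by the prefix of \<open>w\<close> preceding them, so they may overlap.\<close>

definition occurs_twice :: "'a list \<Rightarrow> 'a list \<Rightarrow> bool" where
  "occurs_twice p w \<longleftrightarrow>
    (\<exists>x y x' y'. w = x @ p @ y \<and> w = x' @ p @ y' \<and> x \<noteq> x')"

definition piece :: "('a list \<times> 'a list) set \<Rightarrow> 'a list \<Rightarrow> bool" where
  "piece R p \<longleftrightarrow>
    p = []
    \<or> (\<exists>r\<in>R. \<exists>r'\<in>R. r \<noteq> r' \<and> factor_of_side p r \<and> factor_of_side p r')
    \<or> (\<exists>r\<in>R. sublist p (fst r) \<and> sublist p (snd r))
    \<or> (\<exists>w\<in>relation_words R. occurs_twice p w)"

definition small_overlap :: "nat \<Rightarrow> ('a list \<times> 'a list) set \<Rightarrow> bool" where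
  "small_overlap n R \<longleftrightarrow>
    (\<forall>w\<in>relation_words R.
      \<not> (\<exists>ps. length ps < n \<and> (\<forall>p\<in>set ps. piece R p) \<and> w = concat ps))"

section \<open>Deterministic two-tape Turing machines\<close>

datatype move = MoveLeft | Stay | MoveRight

fun offset :: "move \<Rightarrow> int" where
  "offset MoveLeft = -1"
| "offset Stay = 0"
| "offset MoveRight = 1"

text \<open>A tape is infinite in both directions and comes with the position of its head.\<close>

type_synonym 's tape = "(int \<Rightarrow> 's) \<times> int"

type_synonym ('q, 's) config = "'q \<times> 's tape \<times> 's tape"

record ('q, 's) two_tape_tm =
  states :: "'q set"
  tape_alphabet :: "'s set"
  start :: 'q
  accept :: 'q
  reject :: 'q
  delta :: "'q \<Rightarrow> 's \<Rightarrow> 's \<Rightarrow> 'q \<times> ('s \<times> move) \<times> ('s \<times> move)"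

definition is_two_tape_tm :: "('q, 's) two_tape_tm \<Rightarrow> bool" where
  "is_two_tape_tm M \<longleftrightarrow>
    finite (states M) \<and> finite (tape_alphabet M) \<and>
    start M \<in> states M \<and> accept M \<in> states M \<and> reject M \<in> states M \<and>
    accept M \<noteq> reject M \<and>
    (\<forall>q\<in>states M. \<forall>a\<in>tape_alphabet M. \<forall>b\<in>tape_alphabet M.
      delta M q a b \<in> states M \<times> (tape_alphabet M \<times> UNIV) \<times> (tape_alphabet M \<times> UNIV))"

fun scanned :: "'s tape \<Rightarrow> 's" where
  "scanned (f, h) = f h"

fun act :: "'s \<times> move \<Rightarrow> 's tape \<Rightarrow> 's tape" where
  "act (s, m) (f, h) = (f(h := s), h + offset m)"

text \<open>The machine halts on entering the accepting or the rejecting state.\<close>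

fun step :: "('q, 's) two_tape_tm \<Rightarrow> ('q, 's) config \<Rightarrow> ('q, 's) config" where
  "step M (q, t1, t2) =
    (if q = accept M \<or> q = reject M then (q, t1, t2)
     else (case delta M q (scanned t1) (scanned t2) of
       (q', a1, a2) \<Rightarrow> (q', act a1 t1, act a2 t2)))"

definition answers_within ::
    "('q, 's) two_tape_tm \<Rightarrow> ('q, 's) config \<Rightarrow> nat \<Rightarrow> bool \<Rightarrow> bool" where
  "answers_within M c n b \<longleftrightarrow>
    (\<exists>t\<le>n. fst ((step M ^^ t) c) = (if b then accept M else reject M))"

section \<open>Solving the word problem\<close>

datatype 'a tape_symbol = Blank | Sep | Gen 'a | Aux nat

text \<open>The input \<open>#u#v#p#\<close> is written on the first tape; the second tape is blank. The head of
  the first tape starts on the separator between \<open>u\<close> and \<open>v\<close>. Starting at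
  the left end would rule out a running time bounded in terms of the shorter input word, as the
  machine would need more than \<open>length u\<close> steps to reach \<open>v\<close>.\<close>

definition input_word :: "'a list \<Rightarrow> 'a list \<Rightarrow> 'a list \<Rightarrow> 'a tape_symbol list" where
  "input_word u v p = [Sep] @ map Gen u @ [Sep] @ map Gen v @ [Sep] @ map Gen p @ [Sep]"

definition input_tape :: "'a list \<Rightarrow> 'a list \<Rightarrow> 'a list \<Rightarrow> 'a tape_symbol tape" where
  "input_tape u v p =
    (\<lambda>i. if 0 \<le> i \<and> i < int (length (input_word u v p))
         then input_word u v p ! nat i else Blank,
     int (length u) + 1)"

definition initial_config ::
    "('q, 'a tape_symbol) two_tape_tm \<Rightarrow> 'a list \<Rightarrow> 'a list \<Rightarrow> 'a list
      \<Rightarrow> ('q, 'a tape_symbol) config" where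
  "initial_config M u v p = (start M, input_tape u v p, (\<lambda>_. Blank, 0))"

definition solves_word_problem_in_time ::
    "('q, 'a tape_symbol) two_tape_tm \<Rightarrow> 'a set \<Rightarrow> ('a list \<times> 'a list) set
      \<Rightarrow> ('a list \<Rightarrow> 'a list \<Rightarrow> nat) \<Rightarrow> bool" where
  "solves_word_problem_in_time M A R T \<longleftrightarrow>
    is_two_tape_tm M \<and> {Blank, Sep} \<union> Gen ` A \<subseteq> tape_alphabet M \<and>
    (\<forall>u\<in>lists A. \<forall>v\<in>lists A.
      answers_within M (initial_config M u v []) (T u v)
        (represented_element A R u = represented_element A R v))"

end

theory Submission
  imports Defs
begin

text \<open>
  Write each relation word as \<open>r = H r @ Z r\<close>, where \<open>Z r\<close> is the longest suffix of \<open>r\<close> that is a piece.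
  By \<open>C(4)\<close>, \<open>H r\<close> is not a product of two pieces. An occurrence of \<open>H r\<close> in a word is clean if
  no occurrence of another \<open>H s\<close> starts strictly inside it; every occurrence of \<open>r\<close> gives a clean
  occurrence of \<open>H r\<close>. The prefix of a word before its first clean occurrence of some \<open>H r\<close> is never touched
  by rewriting, and \<open>H r\<close> itself can only be exchanged with \<open>H r'\<close>, where \<open>r'\<close> is the other side of the
  relation. So the class of a word can be read off from left to right: the question
  whether \<open>u\<close> and \<open>v\<close> are equivalent and the class contains a word with prefix \<open>p\<close>, for a piece \<open>p\<close>,
  reduces to the same question for shorter words up to a new piece in front of them, and the
  reduction depends only on prefixes of bounded length. This gives a deterministic two-tape automaton whose running time
  is linear in the length of its second word. The Turing machine finds the shorter input word up to
  a factor of two by excursions of doubling length around the middle separator, copies it to the second tape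
  and runs the automaton. If \<open>v\<close> is the shorter word, both words are read from
  right to left, using the automaton of the reversed presentation.
\<close>


section \<open>Pieces and relation words\<close>

definition partner :: "('a list \<times> 'a list) set \<Rightarrow> 'a list \<Rightarrow> 'a list \<Rightarrow> bool" where
  "partner R r r' \<longleftrightarrow> (r, r') \<in> R \<or> (r', r) \<in> R"

definition tail_start :: "('a list \<times> 'a list) set \<Rightarrow> 'a list \<Rightarrow> nat" where
  "tail_start R r = (LEAST n. piece R (drop n r))"

lemma piece_Nil [simp]: "piece R []"
  by (simp add: piece_def)

lemma piece_sublist:
  assumes "piece R p" and "sublist q p"
  shows "piece R q"
proof -
  have f: "factor_of_side q r" if "factor_of_side p r" for r
    using that assms(2) unfolding factor_of_side_def by (meson sublist_order.order_trans)
  obtain a b where p: "p = a @ q @ b"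
    using assms(2) by (auto simp: sublist_def)
  have o: "occurs_twice q w" if "occurs_twice p w" for w
  proof -
    from that obtain x y x' y' where "w = x @ p @ y" "w = x' @ p @ y'" "x \<noteq> x'"
      unfolding occurs_twice_def by blast
    then have "w = (x @ a) @ q @ (b @ y)" "w = (x' @ a) @ q @ (b @ y')" "x @ a \<noteq> x' @ a"
      using p by auto
    then show ?thesis unfolding occurs_twice_def by blast
  qed
  from assms(1) consider "p = []" | r r' where "r \<in> R" "r' \<in> R" "r \<noteq> r'" "factor_of_side p r" "factor_of_side p r'"
    | r where "r \<in> R" "sublist p (fst r)" "sublist p (snd r)"
    | w where "w \<in> relation_words R" "occurs_twice p w"
    unfolding piece_def by blast
  then show ?thesis
  proof cases
    case 1 then show ?thesis using assms(2) by simp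
  next
    case 2 then show ?thesis using f unfolding piece_def by blast
  next
    case 3 then show ?thesis using assms(2) unfolding piece_def
      by (meson sublist_order.order_trans)
  next
    case 4 then show ?thesis using o unfolding piece_def by blast
  qed
qed

text \<open>The form in which pieces arise from overlaps: distinct relation words are the two sides
  of one relation or sides of different relations, and within one word the positions
  \<open>x\<close> and \<open>x'\<close> differ.\<close>

lemma pieceI:
  assumes "r \<in> relation_words R" "s \<in> relation_words R"
    and "r = x @ p @ y" "s = x' @ p @ y'" and "r \<noteq> s \<or> x \<noteq> x'"
  shows "piece R p"
proof (cases "r = s")
  case True
  then show ?thesis using assms unfolding piece_def occurs_twice_def by blast
next
  case False
  obtain \<rho> where \<rho>: "\<rho> \<in> R" "r = fst \<rho> \<or> r = snd \<rho>"
    using assms(1) unfolding relation_words_def by blast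
  obtain \<sigma> where \<sigma>: "\<sigma> \<in> R" "s = fst \<sigma> \<or> s = snd \<sigma>"
    using assms(2) unfolding relation_words_def by blast
  have sub: "sublist p r" "sublist p s"
    using assms(3,4) by (auto simp: sublist_def)
  then have "factor_of_side p \<rho>" "factor_of_side p \<sigma>"
    using \<rho> \<sigma> unfolding factor_of_side_def by auto
  moreover have "sublist p (fst \<rho>) \<and> sublist p (snd \<rho>)" if "\<rho> = \<sigma>"
    using that \<rho> \<sigma> False sub by auto
  ultimately show ?thesis using \<rho>(1) \<sigma>(1) unfolding piece_def by blast
qed

locale C4 =
  fixes R :: "('a list \<times> 'a list) set"
  assumes C4: "small_overlap 4 R"
begin

abbreviation "W \<equiv> relation_words R"
abbreviation "pc \<equiv> piece R"
abbreviation "ptn \<equiv> partner R"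
definition "H r = take (tail_start R r) r"
definition "Z r = drop (tail_start R r) r"

lemma not_three_pieces:
  assumes "r \<in> W" "r = a @ b @ c" "pc a" "pc b" "pc c"
  shows False
proof -
  have "r = concat [a, b, c]" using assms by simp
  moreover have "\<forall>p\<in>set [a, b, c]. pc p" "length [a, b, c] < 4" using assms by auto
  ultimately show False using C4 assms(1) unfolding small_overlap_def by blast
qed

lemma HZ [simp]: "H r @ Z r = r"
  by (simp add: H_def Z_def)

lemma pc_Z: "pc (Z r)"
proof -
  have "pc (drop (length r) r)" by simp
  then show ?thesis unfolding Z_def tail_start_def by (rule LeastI)
qed

lemma H_le:
  assumes "r = x @ s" "pc s"
  shows "length (H r) \<le> length x"
proof -
  have "pc (drop (length x) r)" using assms by simp
  then have "tail_start R r \<le> length x" unfolding tail_start_def by (rule Least_le)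
  then show ?thesis unfolding H_def by simp
qed

lemma H_not_two_pieces:
  assumes "r \<in> W" "H r = a @ b" "pc a" "pc b"
  shows False
  by (rule not_three_pieces[OF assms(1), of a b "Z r"]) (use assms pc_Z HZ[of r] in auto)

lemma H_not_piece: "r \<in> W \<Longrightarrow> \<not> pc (H r)"
  using H_not_two_pieces[of r "H r" "[]"] by auto

lemma H_neq_Nil [simp]: "r \<in> W \<Longrightarrow> H r \<noteq> []"
  using H_not_piece[of r] by auto

text \<open>A second occurrence of \<open>H r\<close> in a relation word would make it a piece. So
  the word at a site determines the relation word it belongs to.\<close>

lemma H_factor:
  assumes "r \<in> W" "s \<in> W" "s = x @ H r @ y"
  shows "r = s \<and> x = []"
proof (rule ccontr)
  assume "\<not> ?thesis"
  then have "pc (H r)"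
    using pieceI[of r R s "[]" "H r" "Z r" x y] assms by auto
  then show False using H_not_piece assms by blast
qed

lemma H_prefix_unique:
  assumes "r \<in> W" "s \<in> W" "prefix (H r) w" "prefix (H s) w"
  shows "r = s"
proof -
  have "prefix (H r) (H s) \<or> prefix (H s) (H r)"
    using assms prefix_same_cases by blast
  then show ?thesis
  proof
    assume "prefix (H r) (H s)"
    then obtain y where "H s = H r @ y" by (auto simp: prefix_def)
    then have "s = [] @ H r @ (y @ Z s)" using HZ[of s] by simp
    then show ?thesis using H_factor assms by blast
  next
    assume "prefix (H s) (H r)"
    then obtain y where "H r = H s @ y" by (auto simp: prefix_def)
    then have "r = [] @ H s @ (y @ Z r)" using HZ[of r] by simp
    then show ?thesis using H_factor assms by blast
  qed
qed

lemma partner_sym: "ptn r r' \<Longrightarrow> ptn r' r"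
  by (auto simp: partner_def)

lemma partner_W: assumes "ptn r r'" shows "r \<in> W" "r' \<in> W"
  using assms by (force simp: partner_def relation_words_def)+

lemma partner_ex: "r \<in> W \<Longrightarrow> \<exists>r'. ptn r r'"
  by (force simp: partner_def relation_words_def)

lemma W_not_piece: "r \<in> W \<Longrightarrow> \<not> pc r"
  using not_three_pieces[of r r "[]" "[]"] by auto

lemma partner_neq: assumes "ptn r r'" shows "r \<noteq> r'"
proof
  assume "r = r'"
  then have "(r, r) \<in> R" using assms by (auto simp: partner_def)
  then have "pc r" unfolding piece_def by fastforce
  then show False using W_not_piece partner_W assms by blast
qed

text \<open>A side shared by two relations would be a piece, against \<open>C(4)\<close>. A site
  therefore has only the two states \<open>r\<close> and \<open>r'\<close>, and flipping twice
  returns to the first.\<close>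

lemma partner_unique:
  assumes "ptn r r'" "ptn r r''"
  shows "r' = r''"
proof (rule ccontr)
  assume n: "r' \<noteq> r''"
  obtain \<rho> where \<rho>: "\<rho> \<in> R" "\<rho> = (r, r') \<or> \<rho> = (r', r)" using assms by (auto simp: partner_def)
  obtain \<sigma> where \<sigma>: "\<sigma> \<in> R" "\<sigma> = (r, r'') \<or> \<sigma> = (r'', r)" using assms by (auto simp: partner_def)
  have "\<rho> \<noteq> \<sigma>" using \<rho> \<sigma> n by auto
  moreover have "factor_of_side r \<rho>" "factor_of_side r \<sigma>"
    using \<rho> \<sigma> unfolding factor_of_side_def by auto
  ultimately have "pc r" using \<rho>(1) \<sigma>(1) unfolding piece_def by blast
  then show False using W_not_piece partner_W assms by blast
qed

section \<open>Rewriting and clean sites\<close>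

definition rw :: "'a list \<Rightarrow> 'a list \<Rightarrow> bool" where
  "rw u v \<longleftrightarrow> (\<exists>a b r r'. ptn r r' \<and> u = a @ r @ b \<and> v = a @ r' @ b)"

abbreviation "eqv \<equiv> rw\<^sup>*\<^sup>*"

definition clean :: "'a list \<Rightarrow> 'a list \<Rightarrow> bool" where
  "clean r w \<longleftrightarrow> r \<in> W \<and> (\<exists>w'. w = H r @ w' \<and>
     (\<forall>s x y. s \<in> W \<longrightarrow> H r = x @ y \<longrightarrow> x \<noteq> [] \<longrightarrow> y \<noteq> [] \<longrightarrow> \<not> prefix (H s) (y @ w')))"

definition inactive :: "'a list \<Rightarrow> 'a list \<Rightarrow> bool" where
  "inactive a w \<longleftrightarrow> (\<forall>a1 a2 r. a = a1 @ a2 \<longrightarrow> a2 \<noteq> [] \<longrightarrow> \<not> clean r (a2 @ w))"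

text \<open>The pair \<open>(q, s)\<close> stands for the word \<open>H q @ s\<close> beginning at a
  site. A flip needs the whole relation word, that is, \<open>Z q\<close> at the start of the
  rest.\<close>

inductive site_step :: "'a list \<times> 'a list \<Rightarrow> 'a list \<times> 'a list \<Rightarrow> bool" where
  tail: "rw s s' \<Longrightarrow> site_step (q, s) (q, s')"
| flip: "ptn q q' \<Longrightarrow> site_step (q, Z q @ t) (q', Z q' @ t)"

lemma cleanD: "clean r w \<Longrightarrow> r \<in> W" "clean r w \<Longrightarrow> prefix (H r) w"
  by (auto simp: clean_def)

lemma clean_overlap:
  assumes "clean r (H r @ w')" "s \<in> W" "H r = x @ y" "x \<noteq> []" "y \<noteq> []"
  shows "\<not> prefix (H s) (y @ w')"
  using assms unfolding clean_def by auto

lemma rw_sym: "rw u v \<Longrightarrow> rw v u"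
  unfolding rw_def using partner_sym by blast

lemma eqv_sym: "eqv u v \<Longrightarrow> eqv v u"
  by (induction rule: rtranclp_induct) (auto intro: rw_sym converse_rtranclp_into_rtranclp)

lemma eqv_trans: "eqv u v \<Longrightarrow> eqv v w \<Longrightarrow> eqv u w"
  by auto

lemma rw_ctx: "rw u v \<Longrightarrow> rw (a @ u @ b) (a @ v @ b)"
  unfolding rw_def by (metis append.assoc)

lemma eqv_ctx: "eqv u v \<Longrightarrow> eqv (a @ u @ b) (a @ v @ b)"
  by (induction rule: rtranclp_induct) (auto intro: rw_ctx rtranclp.rtrancl_into_rtrancl)

lemma eqv_left: "eqv u v \<Longrightarrow> eqv (a @ u) (a @ v)"
  using eqv_ctx[of u v a "[]"] by simp

lemma eqv_rel: "ptn r r' \<Longrightarrow> eqv (r @ b) (r' @ b)"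
  by (rule r_into_rtranclp) (simp add: rw_def, metis append_Nil)

lemma eqv_flip: "ptn r r' \<Longrightarrow> eqv (H r @ Z r @ b) (H r' @ Z r' @ b)"
  using eqv_rel[of r r' b] by (metis HZ append.assoc)

lemma site_step_eqv: "site_step (r, w) (q, s) \<Longrightarrow> eqv (H r @ w) (H q @ s)"
  by (auto elim!: site_step.cases intro: eqv_left eqv_flip)

lemma site_step_star_eqv: "site_step\<^sup>*\<^sup>* (r, w) (q, s) \<Longrightarrow> eqv (H r @ w) (H q @ s)"
proof (induction "(q, s)" arbitrary: q s rule: rtranclp_induct)
  case (step y)
  then show ?case by (metis site_step_eqv eqv_trans surj_pair)
qed simp

text \<open>Let \<open>H s\<close> start strictly inside \<open>H r\<close>. If it ends within
  \<open>r\<close>, \<open>H_factor\<close> applies. If it reaches the end of \<open>r\<close>, the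
  overlap is a suffix of \<open>r\<close> that is a piece and longer than \<open>Z r\<close>,
  against the choice of \<open>Z r\<close>.\<close>

lemma full_clean:
  assumes "r \<in> W"
  shows "clean r (r @ b)"
proof -
  have "\<not> prefix (H s) (y @ Z r @ b)" if s: "s \<in> W" and xy: "H r = x @ y" "x \<noteq> []" "y \<noteq> []" for s x y
  proof
    assume "prefix (H s) (y @ Z r @ b)"
    then have "prefix (H s) (y @ Z r) \<or> prefix (y @ Z r) (H s)"
      by (metis append.assoc prefixI prefix_same_cases)
    then show False
    proof
      assume "prefix (H s) (y @ Z r)"
      then obtain e where "y @ Z r = H s @ e" by (auto simp: prefix_def)
      then have "r = x @ H s @ e" using xy HZ[of r] by (metis append.assoc)
      then show False using H_factor[OF s assms] xy by blast
    next
      assume "prefix (y @ Z r) (H s)"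
      then obtain e where "H s = (y @ Z r) @ e" by (auto simp: prefix_def)
      then have "s = [] @ (y @ Z r) @ (e @ Z s)" using HZ[of s] by simp
      moreover have r: "r = x @ (y @ Z r)" using xy HZ[of r] by simp
      ultimately have "pc (y @ Z r)"
        using pieceI[of r R s x "y @ Z r" "[]" "[]" "e @ Z s"] assms s xy by auto
      then have "length (H r) \<le> length x" using H_le r by blast
      then show False using xy by simp
    qed
  qed
  then show ?thesis unfolding clean_def using assms by (intro conjI exI[of _ "Z r @ b"]) auto
qed

text \<open>A relation word that starts before \<open>H q\<close> and reaches into it cannot contain
  \<open>H q\<close>, by \<open>H_factor\<close>. The overlap \<open>x\<close> is then a piece, so
  it lies in \<open>Z T\<close> and leaves \<open>H T\<close> within \<open>a\<close>.\<close>

lemma H_before: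
  assumes "T \<in> W" "q \<in> W" "a \<noteq> []" "prefix T (a @ H q @ s)"
  shows "prefix T a \<or> (\<exists>x. T = a @ x \<and> pc x \<and> prefix (H T) a)"
proof (cases "prefix T a")
  case False
  then have "prefix a T" using assms(4) by (meson prefixI prefix_same_cases)
  then obtain x where T: "T = a @ x" by (auto simp: prefix_def)
  then have "prefix x (H q @ s)" using assms(4) by simp
  then have "prefix x (H q) \<or> prefix (H q) x" by (meson prefixI prefix_same_cases)
  moreover have "\<not> prefix (H q) x"
  proof
    assume "prefix (H q) x"
    then obtain e where "x = H q @ e" by (auto simp: prefix_def)
    then show False using H_factor[OF assms(2,1), of a e] T assms by auto
  qed
  ultimately obtain e where "H q = x @ e" by (auto simp: prefix_def)
  then have "q = [] @ x @ (e @ Z q)" using HZ[of q] by simp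
  then have "pc x" using pieceI[of T R q a x "[]" "[]" "e @ Z q"] T assms by auto
  moreover have "prefix (H T) a"
    using H_le[OF T \<open>pc x\<close>] T HZ[of T] by (metis prefixI prefix_length_prefix)
  ultimately show ?thesis using T by blast
qed simp

text \<open>The site may have been rewritten to \<open>H q @ s\<close>, whereas inactivity of
  \<open>a\<close> is known only before the original \<open>H r @ w'\<close>. If \<open>T\<close>
  reaches into \<open>H q\<close>, then \<open>H T\<close> lies in \<open>a\<close> and is not clean
  there, so some \<open>H s'\<close> starts inside it. This \<open>H s'\<close> must end inside
  \<open>H r\<close>, so it is the product of an overlap with \<open>T\<close> and an overlap with
  \<open>r\<close>: two pieces, against \<open>C(4)\<close>.\<close>

lemma no_relation_word_before_site:
  assumes clean: "clean r (H r @ w')" and inactive: "inactive a (H r @ w')" and q: "q \<in> W" and T: "T \<in> W"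
    and a: "a = c @ a'" "a' \<noteq> []"
  shows "\<not> prefix T (a' @ H q @ s)"
proof
  assume "prefix T (a' @ H q @ s)"
  then consider "prefix T a'" | x where "T = a' @ x" "pc x" "prefix (H T) a'"
    using H_before[OF T q a(2)] by blast
  then show False
  proof cases
    case 1
    then obtain e where "a' = T @ e" by (auto simp: prefix_def)
    then have "clean T (a' @ H r @ w')" using full_clean[OF T] by simp
    then show False using inactive a unfolding inactive_def by blast
  next
    case 2
    obtain e where e: "a' = H T @ e" using 2 by (auto simp: prefix_def)
    have "\<not> clean T (a' @ H r @ w')" using inactive a unfolding inactive_def by blast
    then obtain s' x1 y1 where s': "s' \<in> W" "H T = x1 @ y1" "x1 \<noteq> []" "y1 \<noteq> []"
      "prefix (H s') (y1 @ e @ H r @ w')"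
      unfolding clean_def using T e by auto
    let ?a2 = "y1 @ e"
    have TT: "T = x1 @ ?a2 @ x" using 2 e s' by simp
    have r: "r \<in> W" using clean cleanD by blast
    have "\<not> prefix (H s') ?a2"
    proof
      assume "prefix (H s') ?a2"
      then obtain e' where "?a2 = H s' @ e'" by (auto simp: prefix_def)
      then have "T = x1 @ H s' @ (e' @ x)" using TT by simp
      then show False using H_factor[OF s'(1) T] s' by blast
    qed
    then have "prefix ?a2 (H s')" using s'(5) by (metis append.assoc prefixI prefix_same_cases)
    then obtain x2 where x2: "H s' = ?a2 @ x2" by (auto simp: prefix_def)
    then have "prefix x2 (H r @ w')" using s'(5) by simp
    then have "prefix x2 (H r) \<or> prefix (H r) x2" by (meson prefixI prefix_same_cases)
    moreover have "\<not> prefix (H r) x2"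
    proof
      assume "prefix (H r) x2"
      then obtain e' where "x2 = H r @ e'" by (auto simp: prefix_def)
      then have "s' = ?a2 @ H r @ (e' @ Z s')" using x2 HZ[of s'] by (metis append.assoc)
      then show False using H_factor[OF r s'(1)] s' by blast
    qed
    ultimately obtain e' where "H r = x2 @ e'" by (auto simp: prefix_def)
    then have "r = [] @ x2 @ (e' @ Z r)" using HZ[of r] by simp
    moreover have s2: "s' = ?a2 @ x2 @ Z s'" using x2 HZ[of s'] by simp
    ultimately have "pc x2"
      using pieceI[of s' R r ?a2 x2 "Z s'" "[]" "e' @ Z r"] s' r by auto
    moreover have "pc ?a2"
      using pieceI[of T R s' x1 ?a2 x "[]" "x2 @ Z s'"] TT s2 s' T by simp
    ultimately show False using H_not_two_pieces[OF s'(1) x2] by blast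
  qed
qed

lemma first_site:
  obtains "inactive w []" | a r w' where "w = a @ H r @ w'" "clean r (H r @ w')" "inactive a (H r @ w')"
proof -
  have "inactive w [] \<or> (\<exists>a r w'. w = a @ H r @ w' \<and> clean r (H r @ w') \<and> inactive a (H r @ w'))"
  proof (induction w)
    case Nil
    then show ?case by (simp add: inactive_def)
  next
    case (Cons x w)
    show ?case
    proof (cases "\<exists>r. clean r (x # w)")
      case True
      then obtain r where r: "clean r (x # w)" by blast
      then obtain w' where "x # w = H r @ w'" by (auto simp: clean_def)
      then show ?thesis using r by (intro disjI2 exI[of _ "[]"] exI[of _ r] exI[of _ w']) (auto simp: inactive_def)
    next
      case False
      have *: "inactive (x # a) w2" if "inactive a w2" "w = a @ w2" for a w2
        using that False unfolding inactive_def by (auto simp: Cons_eq_append_conv)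
      from Cons show ?thesis
      proof
        assume "inactive w []" then show ?thesis using * by simp
      next
        assume "\<exists>a r w'. w = a @ H r @ w' \<and> clean r (H r @ w') \<and> inactive a (H r @ w')"
        then show ?thesis using * by (metis append_Cons)
      qed
    qed
  qed
  then show ?thesis using that by blast
qed

lemma inactive_no_rw:
  assumes "inactive w []"
  shows "\<not> rw w v"
proof
  assume "rw w v"
  then obtain a b r r' where r: "ptn r r'" "w = a @ r @ b" unfolding rw_def by blast
  then have "clean r (r @ b)" using full_clean partner_W by blast
  moreover have "r @ b \<noteq> []" using partner_W(1)[OF r(1)] H_neq_Nil[of r] by (metis HZ append_is_Nil_conv)
  ultimately show False using assms r unfolding inactive_def by fastforce
qed

text \<open>Cleanness is not known to survive rewriting of the rest, but it holds at the start and,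
  by \<open>full_clean\<close>, after every flip. The rest at the latest such moment is
  \<open>s0\<close>.\<close>

lemma site_step_origin:
  assumes "(site_step ^^ n) (r, w) (q, s)" "clean r (H r @ w)"
  shows "\<exists>s0 k. k \<le> n \<and> clean q (H q @ s0) \<and> (rw ^^ k) s0 s"
  using assms
proof (induction n arbitrary: q s)
  case 0
  then show ?case by (intro exI[of _ w] exI[of _ 0]) auto
next
  case (Suc n)
  then obtain q1 s1 where 1: "(site_step ^^ n) (r, w) (q1, s1)" "site_step (q1, s1) (q, s)" by auto
  from Suc.IH[OF this(1) Suc.prems(2)] obtain s0 k where k: "k \<le> n" "clean q1 (H q1 @ s0)" "(rw ^^ k) s0 s1" by blast
  from 1(2) show ?case
  proof cases
    case tail
    then have "(rw ^^ Suc k) s0 s" using k by auto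
    then show ?thesis using k tail by (intro exI[of _ s0] exI[of _ "Suc k"]) auto
  next
    case (flip t)
    then have "clean q (H q @ Z q @ t)" using full_clean[of q t] partner_W by (metis HZ append.assoc)
    then show ?thesis using flip by (intro exI[of _ s] exI[of _ 0]) auto
  qed
qed

lemma path_W: "(site_step ^^ n) (r, w) (q, s) \<Longrightarrow> r \<in> W \<Longrightarrow> q \<in> W"
  by (induction n arbitrary: q s) (auto elim!: site_step.cases dest: partner_W)

text \<open>The induction is over all shorter paths because the hypothesis is used twice: for the
  first \<open>m\<close> steps, and for the rewriting of the rest since the latest flip. The second
  use excludes a relation word that starts strictly inside \<open>H q\<close>.\<close>

theorem path_structure:
  assumes "(rw ^^ n) w v" "w = a @ H r @ w'" "clean r (H r @ w')" "inactive a (H r @ w')"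
  shows "\<exists>q s. v = a @ H q @ s \<and> (site_step ^^ n) (r, w') (q, s)"
  using assms
proof (induction n arbitrary: w v a r w' rule: less_induct)
  case (less n)
  show ?case
  proof (cases n)
    case 0
    then show ?thesis using less.prems by auto
  next
    case (Suc m)
    then obtain v1 where v1: "(rw ^^ m) w v1" "rw v1 v" using less.prems by auto
    from less.IH[OF _ v1(1) less.prems(2-4)] Suc obtain q s
      where qs: "v1 = a @ H q @ s" "(site_step ^^ m) (r, w') (q, s)" by auto
    have q: "q \<in> W" using path_W qs cleanD less.prems by blast
    from site_step_origin[OF qs(2) less.prems(3)] obtain s0 k
      where k: "k \<le> m" "clean q (H q @ s0)" "(rw ^^ k) s0 s" by blast
    from v1(2) obtain c d T T' where T: "ptn T T'" "v1 = c @ T @ d" "v = c @ T' @ d"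
      unfolding rw_def by blast
    have TW: "T \<in> W" using T partner_W by blast
    have "prefix a c"
    proof (rule ccontr)
      assume "\<not> prefix a c"
      moreover have "prefix a c \<or> prefix c a"
        using T qs by (metis prefixI prefix_same_cases)
      ultimately obtain a' where a': "a = c @ a'" "a' \<noteq> []" by (auto simp: prefix_def)
      then have "prefix T (a' @ H q @ s)" using T qs by simp
      then show False
        using no_relation_word_before_site[OF less.prems(3,4) q TW a'] by blast
    qed
    then obtain c' where c: "c = a @ c'" by (auto simp: prefix_def)
    then have eq: "H q @ s = c' @ T @ d" using T qs by simp
    consider "c' = []" | "prefix (H q) c'" | y where "H q = c' @ y" "c' \<noteq> []" "y \<noteq> []"
      using eq by (metis append.right_neutral prefix_def prefix_order.order_refl prefixI prefix_same_cases)
    then show ?thesis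
    proof cases
      case 1
      then have "prefix (H T) (H q @ s)" "prefix (H q) (H q @ s)"
        using eq HZ[of T] by (metis append_Nil append.assoc prefixI)+
      then have "T = q" using H_prefix_unique q TW by blast
      then have "s = Z q @ d" using eq 1 HZ[of q] by (metis append_Nil append.assoc same_append_eq)
      then have "site_step (q, s) (T', Z T' @ d)" using site_step.flip T \<open>T = q\<close> by blast
      moreover have "v = a @ H T' @ Z T' @ d" using T c 1 by (metis HZ append.assoc append.right_neutral)
      ultimately show ?thesis using qs Suc by auto
    next
      case 2
      then obtain c2 where c2: "c' = H q @ c2" by (auto simp: prefix_def)
      then have "s = c2 @ T @ d" using eq by simp
      then have "rw s (c2 @ T' @ d)" unfolding rw_def using T by blast
      then have "site_step (q, s) (q, c2 @ T' @ d)" by (rule site_step.tail)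
      moreover have "v = a @ H q @ c2 @ T' @ d" using T c c2 by simp
      ultimately show ?thesis using qs Suc by auto
    next
      case (3 y)
      then have pT: "prefix T (y @ s)" using eq by simp
      have nH: "\<not> prefix (H T) (y @ s0)" using clean_overlap[OF k(2) TW 3] .
      have HT: "prefix (H T) T" using HZ[of T] by (metis prefixI)
      \<comment> \<open>The words \<open>s0\<close> and \<open>s\<close> agree up to the first clean
        site of \<open>s0\<close>. Since \<open>H T\<close> ends before that site, it is already
        present in \<open>y @ s0\<close>, against cleanness.\<close>
      consider "s = s0" | a1 q1 s1 z where "s = a1 @ H q1 @ s1" "q1 \<in> W" "s0 = a1 @ z"
      proof (cases rule: first_site[of s0])
        case 1
        then have "s = s0" using k(3) inactive_no_rw by (metis relpowp_E2)
        then show ?thesis using that by blast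
      next
        case (2 a1 r1 w1)
        then obtain q1 s1 where "s = a1 @ H q1 @ s1" "(site_step ^^ k) (r1, w1) (q1, s1)"
          using less.IH[OF _ k(3) 2] k(1) Suc by auto
        then show ?thesis using that(2) path_W 2 cleanD by blast
      qed
      then show ?thesis
      proof cases
        case 1
        then show ?thesis using pT nH HT by (metis prefix_order.order_trans)
      next
        case (2 a1 q1 s1 z)
        then have "prefix T ((y @ a1) @ H q1 @ s1)" using pT by simp
        then have "prefix (H T) (y @ a1)"
          using H_before[OF TW 2(2), of "y @ a1" s1] 3 HT by (auto intro: prefix_order.order_trans)
        then show ?thesis using nH 2 by (metis append.assoc prefix_prefix)
      qed
    qed
  qed
qed

end


context C4 begin

section \<open>Equivalence classes\<close>

lemma inactive_Nil [simp]: "inactive [] w"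
  by (simp add: inactive_def)

lemma inactive_Cons: "inactive (x # a) w \<longleftrightarrow> inactive a w \<and> (\<nexists>r. clean r (x # a @ w))"
proof -
  have "inactive (x # a) w" if "inactive a w" "\<nexists>r. clean r (x # a @ w)"
    using that unfolding inactive_def by (auto simp: Cons_eq_append_conv)
  moreover have "inactive a w \<and> (\<nexists>r. clean r (x # a @ w))" if *: "inactive (x # a) w"
  proof
    show "inactive a w" unfolding inactive_def
      using *[unfolded inactive_def, rule_format, of "x # _"] by auto
    show "\<nexists>r. clean r (x # a @ w)"
      using *[unfolded inactive_def, rule_format, of "[]" "x # a"] by auto
  qed
  ultimately show ?thesis by blast
qed

lemma eqv_strip_Cons:
  assumes "\<nexists>r. clean r (x # w)" "eqv (x # w) v"
  shows "\<exists>v2. v = x # v2 \<and> eqv w v2"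
proof (cases rule: first_site[of "x # w"])
  case 1
  then have "v = x # w" using assms(2) inactive_no_rw by (metis converse_rtranclpE)
  then show ?thesis by simp
next
  case (2 a r w')
  obtain n where "(rw ^^ n) (x # w) v" using assms(2) rtranclp_imp_relpowp by metis
  from path_structure[OF this 2] obtain q s
    where v: "v = a @ H q @ s" "(site_step ^^ n) (r, w') (q, s)" by blast
  have "eqv (H r @ w') (H q @ s)" using v(2) relpowp_imp_rtranclp site_step_star_eqv by metis
  moreover obtain a2 where "a = x # a2"
    using 2 assms(1) by (cases a) auto
  ultimately show ?thesis using v 2 eqv_left by auto
qed

lemma eqv_strip:
  "inactive a w \<Longrightarrow> eqv (a @ w) v \<Longrightarrow> \<exists>v2. v = a @ v2 \<and> eqv w v2"
proof (induction a arbitrary: v)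
  case (Cons x a)
  then have "\<nexists>r. clean r (x # (a @ w))" "inactive a w" by (auto simp: inactive_Cons)
  moreover have "eqv (x # (a @ w)) v" using Cons.prems by simp
  ultimately obtain v2 where "v = x # v2" "eqv (a @ w) v2" using eqv_strip_Cons by blast
  then show ?case using Cons.IH \<open>inactive a w\<close> by auto
qed simp

lemma site_path:
  assumes "clean r (H r @ w)" "eqv (H r @ w) v"
  shows "\<exists>q s. v = H q @ s \<and> site_step\<^sup>*\<^sup>* (r, w) (q, s)"
proof -
  obtain n where "(rw ^^ n) (H r @ w) v" using assms(2) rtranclp_imp_relpowp by metis
  from path_structure[OF this, of "[]", OF _ assms(1)]
  show ?thesis using relpowp_imp_rtranclp by fastforce
qed

text \<open>Left cancellation may fail: \<open>z @ t\<close> and \<open>z @ s\<close> can be equivalent although \<open>t\<close> and \<open>s\<close> are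
  not, but only if some clean site of \<open>z @ t\<close> starts in \<open>z\<close>, that is, if \<open>inactive z t\<close> fails.\<close>

lemma active_site:
  "\<not> inactive z t \<Longrightarrow> \<exists>a b r. z = a @ b \<and> b \<noteq> [] \<and> clean r (b @ t) \<and> inactive a (b @ t)"
proof (induction z)
  case (Cons x z)
  show ?case
  proof (cases "\<exists>r. clean r (x # z @ t)")
    case True
    then obtain r where "clean r ((x # z) @ t)" by auto
    then show ?thesis using inactive_Nil by blast
  next
    case False
    then have "\<not> inactive z t" using Cons.prems by (simp add: inactive_Cons)
    then obtain a b r where *: "z = a @ b" "b \<noteq> []" "clean r (b @ t)" "inactive a (b @ t)"
      using Cons.IH by blast
    then have "inactive (x # a) (b @ t)" using False by (simp add: inactive_Cons)
    moreover have "x # z = (x # a) @ b" using * by simp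
    ultimately show ?thesis using * by blast
  qed
qed simp

lemma active_common_aux:
  assumes "pc b" "clean r (b @ t)" "pc b'" "clean r' (b' @ t)"
  obtains h h' where "H r = b @ h" "H r' = b' @ h'" "prefix h t" "prefix h' t" "\<not> pc h" "\<not> pc h'"
proof -
  have "\<exists>h. H r = b @ h \<and> prefix h t \<and> \<not> pc h" if b: "pc b" "clean r (b @ t)" for b r
  proof -
    have "prefix (H r) (b @ t)" using b cleanD by blast
    moreover have "\<not> prefix (H r) b"
      using b piece_sublist H_not_piece cleanD prefix_imp_sublist by metis
    ultimately have "prefix b (H r)" by (meson prefixI prefix_same_cases)
    then obtain h where h: "H r = b @ h" by (auto simp: prefix_def)
    then have "prefix h t" using \<open>prefix (H r) (b @ t)\<close> by simp
    moreover have "\<not> pc h" using H_not_two_pieces h b cleanD by blast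
    ultimately show ?thesis using h by blast
  qed
  then show ?thesis using that assms by metis
qed

text \<open>Both sites reach into \<open>t\<close>, and by parts that are not pieces, because
  \<open>H r\<close> is not a product of two pieces. The shorter part occurs in both relation words;
  not being a piece, it occurs only once, so the two sites belong to the same relation word and have
  the same offset.\<close>

lemma active_common:
  assumes "pc z" "pc z'" "\<not> inactive z t" "\<not> inactive z' t"
  obtains a a' b where "z = a @ b" "z' = a' @ b" "inactive a (b @ t)" "inactive a' (b @ t)"
proof -
  obtain a b r where b: "z = a @ b" "b \<noteq> []" "clean r (b @ t)" "inactive a (b @ t)"
    using active_site assms(3) by blast
  obtain a' b' r' where b': "z' = a' @ b'" "b' \<noteq> []" "clean r' (b' @ t)" "inactive a' (b' @ t)"
    using active_site assms(4) by blast
  have "pc b" "pc b'"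
    using piece_sublist[OF assms(1), of b] piece_sublist[OF assms(2), of b'] b(1) b'(1) by simp_all
  then obtain h h' where h: "H r = b @ h" "H r' = b' @ h'" "prefix h t" "prefix h' t"
      "\<not> pc h" "\<not> pc h'"
    using active_common_aux[OF \<open>pc b\<close> b(3) \<open>pc b'\<close> b'(3)] by blast
  have W: "r \<in> W" "r' \<in> W" using b b' cleanD by blast+
  have "prefix h h' \<or> prefix h' h" using h prefix_same_cases by blast
  then have "b = b'"
  proof
    assume "prefix h h'"
    then obtain e where "h' = h @ e" by (auto simp: prefix_def)
    then have "r' = b' @ h @ (e @ Z r')" "r = b @ h @ Z r" using h HZ by (metis append.assoc)+
    then show ?thesis using pieceI[of r R r' b h "Z r" b' "e @ Z r'"] W h by blast
  next
    assume "prefix h' h"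
    then obtain e where "h = h' @ e" by (auto simp: prefix_def)
    then have "r = b @ h' @ (e @ Z r)" "r' = b' @ h' @ Z r'" using h HZ by (metis append.assoc)+
    then show ?thesis using pieceI[of r R r' b h' "e @ Z r" b' "Z r'"] W h by blast
  qed
  then show ?thesis using that b b' by blast
qed

section \<open>Equivalence behind two different pieces\<close>

lemma inactive_prefix:
  assumes "inactive z t" "eqv w (z @ t)"
  shows "prefix z w"
  using eqv_strip[OF assms(1) eqv_sym[OF assms(2)]] by auto

lemma inactive_imp:
  assumes "inactive z t" "eqv (z @ t) (z @ s)"
  shows "eqv (z' @ t) (z' @ s)"
  using eqv_strip[OF assms] eqv_left by auto

text \<open>A context with an active site identifies at least as much as any other: an inactive
  \<open>z'\<close> can be cancelled, and two active contexts share the part \<open>b\<close> where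
  the site starts, so only the inactive parts before it are exchanged.\<close>

lemma active_imp:
  assumes "pc z" "pc z'" "\<not> inactive z t" "eqv (z' @ t) (z' @ s)"
  shows "eqv (z @ t) (z @ s)"
proof (cases "inactive z' t")
  case True
  then show ?thesis using inactive_imp assms by blast
next
  case False
  then obtain a a' b where *: "z = a @ b" "z' = a' @ b" "inactive a (b @ t)" "inactive a' (b @ t)"
    using active_common assms by metis
  then have "eqv (b @ t) (b @ s)" using eqv_strip[OF *(4), of "z' @ s"] assms by auto
  then show ?thesis using * eqv_left by auto
qed

lemma comparable:
  assumes "pc z" "pc z'"
  shows "(\<forall>s. eqv (z @ t) (z @ s) \<longrightarrow> eqv (z' @ t) (z' @ s)) \<or>
         (\<forall>s. eqv (z' @ t) (z' @ s) \<longrightarrow> eqv (z @ t) (z @ s))"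
  using active_imp[OF assms] inactive_imp by blast

text \<open>The contexts are compared at the middle word \<open>t2\<close>; the coarser one carries
  both links.\<close>

lemma zigzag:
  assumes "pc z" "pc z'" "eqv (z @ t1) (z @ t2)" "eqv (z' @ t2) (z' @ t3)"
  shows "eqv (z @ t1) (z @ t3) \<or> eqv (z' @ t1) (z' @ t3)"
proof -
  have "eqv (z @ t2) (z @ t1)" using assms eqv_sym by blast
  with comparable[OF assms(1,2), of t2] consider "eqv (z' @ t2) (z' @ t1)" | "eqv (z @ t2) (z @ t3)"
    using assms by blast
  then show ?thesis
    by cases (use assms eqv_sym eqv_trans in blast)+
qed

text \<open>A normal form for paths: no flip or two flips if the path ends in \<open>r\<close>, one
  flip if it ends in \<open>r'\<close>. The words \<open>t\<close> and \<open>t'\<close> are what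
  follows \<open>Z r\<close> or \<open>Z r'\<close> at the moments of the flips.\<close>

lemma site_step_star_closed:
  assumes "ptn r r'" "site_step\<^sup>*\<^sup>* (r, w) (q, s)"
  shows "(q = r \<and> (eqv w s \<or> (\<exists>t t'. eqv w (Z r @ t) \<and> eqv s (Z r @ t') \<and> eqv (Z r' @ t) (Z r' @ t'))))
    \<or> (q = r' \<and> (\<exists>t. eqv w (Z r @ t) \<and> eqv s (Z r' @ t)))"
  using assms(2)
proof (induction "(q, s)" arbitrary: q s rule: rtranclp_induct)
  case base
  then show ?case by simp
next
  case (step y)
  obtain q1 s1 where y: "y = (q1, s1)" by fastforce
  from step(2) show ?case unfolding y
  proof cases
    case tail
    then have "eqv s s1" using rw_sym by blast
    then show ?thesis using step(3)[OF y] tail eqv_trans eqv_sym by metis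
  next
    case (flip t2)
    consider "q1 = r" "q = r'" | "q1 = r'" "q = r"
      using step(3)[OF y] flip partner_unique partner_sym assms(1) by metis
    then show ?thesis
    proof cases
      case 1
      from step(3)[OF y] consider "eqv w (Z r @ t2)" |
        t t' where "eqv w (Z r @ t)" "eqv (Z r @ t2) (Z r @ t')" "eqv (Z r' @ t) (Z r' @ t')"
        using 1 flip partner_neq assms(1) by auto
      then have "\<exists>t. eqv w (Z r @ t) \<and> eqv (Z r' @ t2) (Z r' @ t)"
      proof cases
        case (2 t t')
        have "eqv (Z r' @ t') (Z r' @ t)" using 2 eqv_sym by blast
        \<comment> \<open>A third flip: the links behind \<open>Z r'\<close> and \<open>Z r\<close>
          merge into one, and depending on its context either the first or the last flip alone
          suffices.\<close>
        from zigzag[OF pc_Z pc_Z 2(2) this]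
        show ?thesis using 2(1) eqv_sym eqv_trans by blast
      qed auto
      then show ?thesis using 1 flip by blast
    next
      case 2
      then show ?thesis using step(3)[OF y] flip partner_neq assms(1) eqv_sym by blast
    qed
  qed
qed

lemma H_append_cancel:
  assumes "r \<in> W" "q \<in> W" "H r @ w = H q @ s"
  shows "q = r \<and> s = w"
proof -
  have "q = r" using H_prefix_unique[of q r "H r @ w"] assms by (metis prefixI)
  then show ?thesis using assms by simp
qed

lemma site_same:
  assumes clean: "clean r (H r @ w)" and pt: "ptn r r'" and eq: "eqv (H r @ w) (H r @ v)"
  shows "eqv w v \<or> (\<exists>t t'. eqv w (Z r @ t) \<and> eqv v (Z r @ t') \<and> eqv (Z r' @ t) (Z r' @ t'))"
proof -
  obtain q s where *: "H r @ v = H q @ s" "site_step\<^sup>*\<^sup>* (r, w) (q, s)" using site_path[OF clean eq] by blast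
  from site_step_star_closed[OF pt *(2)] have "q \<in> W" using pt partner_W by blast
  then have "q = r" "s = v" using H_append_cancel * partner_W pt by blast+
  then show ?thesis using site_step_star_closed[OF pt *(2)] partner_neq pt by blast
qed

lemma site_flip:
  assumes clean: "clean r (H r @ w)" and pt: "ptn r r'"
  shows "eqv (H r @ w) (H r' @ v) \<longleftrightarrow> (\<exists>t. eqv w (Z r @ t) \<and> eqv v (Z r' @ t))"
proof
  assume "eqv (H r @ w) (H r' @ v)"
  then obtain q s where *: "H r' @ v = H q @ s" "site_step\<^sup>*\<^sup>* (r, w) (q, s)" using site_path[OF clean] by blast
  from site_step_star_closed[OF pt *(2)] have "q \<in> W" using pt partner_W by blast
  then have "q = r'" "s = v" using H_append_cancel * partner_W pt by blast+
  then show "\<exists>t. eqv w (Z r @ t) \<and> eqv v (Z r' @ t)" using site_step_star_closed[OF pt *(2)] partner_neq pt by blast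
next
  assume "\<exists>t. eqv w (Z r @ t) \<and> eqv v (Z r' @ t)"
  then obtain t where "eqv w (Z r @ t)" "eqv (Z r' @ t) v" using eqv_sym by blast
  then show "eqv (H r @ w) (H r' @ v)" using eqv_flip[OF pt, of t] eqv_left eqv_trans by metis
qed

lemma site_shape:
  assumes "clean r (H r @ w)" "ptn r r'" "eqv (H r @ w) v"
  shows "prefix (H r) v \<or> prefix (H r') v"
  using site_path[OF assms(1,3)] site_step_star_closed[OF assms(2)] by (metis prefixI)

section \<open>Equivalence with a prescribed possible prefix\<close>

definition poss :: "'a list \<Rightarrow> 'a list \<Rightarrow> bool" where
  "poss p u \<longleftrightarrow> (\<exists>t. eqv u (p @ t))"

definition eqv_poss :: "'a list \<Rightarrow> 'a list \<Rightarrow> 'a list \<Rightarrow> bool" where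
  "eqv_poss p u v \<longleftrightarrow> eqv u v \<and> poss p u"

lemma poss_Nil [simp]: "poss [] u"
  unfolding poss_def by auto

lemma eqv_poss_Nil: "eqv_poss [] u v \<longleftrightarrow> eqv u v"
  by (simp add: eqv_poss_def)

lemma eqv_Nil: "eqv [] v \<longleftrightarrow> v = []"
  using inactive_no_rw[of "[]"] by (metis inactive_Nil converse_rtranclpE rtranclp.rtrancl_refl)

lemma eqv_poss_empty: "eqv_poss p [] v \<longleftrightarrow> p = [] \<and> v = []"
  by (auto simp: eqv_poss_def poss_def eqv_Nil)

lemma eqv_poss_letter:
  assumes "\<nexists>r. clean r (x # u)"
  shows "eqv_poss p (x # u) v \<longleftrightarrow> (p = [] \<or> hd p = x) \<and> (\<exists>v'. v = x # v' \<and> eqv_poss (tl p) u v')"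
proof -
  have e: "eqv (x # u) w \<longleftrightarrow> (\<exists>w'. w = x # w' \<and> eqv u w')" for w
    using eqv_strip_Cons[OF assms] eqv_left[of u _ "[x]"] by auto
  have p: "poss p (x # u) \<longleftrightarrow> (p = [] \<or> hd p = x) \<and> poss (tl p) u"
    unfolding poss_def e by (cases p) auto
  show ?thesis unfolding eqv_poss_def e p by auto
qed

text \<open>A piece contains no \<open>H q\<close>, so \<open>p\<close> must fit into
  \<open>H r\<close> or \<open>H r'\<close>. To see \<open>H r'\<close>, the site has to be flipped,
  which requires \<open>Z r\<close> to be a possible prefix of the rest.\<close>

lemma poss_site:
  assumes clean: "clean r (H r @ u)" and pt: "ptn r r'" and p: "pc p"
  shows "poss p (H r @ u) \<longleftrightarrow> prefix p (H r) \<or> (prefix p (H r') \<and> poss (Z r) u)"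
proof
  assume "poss p (H r @ u)"
  then obtain t where t: "eqv (H r @ u) (p @ t)" by (auto simp: poss_def)
  have long: "prefix p (H q)" if "prefix (H q) (p @ t)" "q \<in> W" for q
  proof -
    have "prefix p (H q) \<or> prefix (H q) p" using that by (meson prefixI prefix_same_cases)
    then show ?thesis using p H_not_piece[OF that(2)] piece_sublist by blast
  qed
  show "prefix p (H r) \<or> (prefix p (H r') \<and> poss (Z r) u)"
  proof (cases "prefix (H r) (p @ t)")
    case True
    then show ?thesis using long partner_W pt by blast
  next
    case False
    then have *: "prefix (H r') (p @ t)" using site_shape[OF clean pt t] by blast
    then obtain s where "p @ t = H r' @ s" by (auto simp: prefix_def)
    then have "poss (Z r) u" using site_flip[OF clean pt] t unfolding poss_def by auto
    then show ?thesis using * long partner_W pt by blast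
  qed
next
  assume "prefix p (H r) \<or> (prefix p (H r') \<and> poss (Z r) u)"
  then show "poss p (H r @ u)"
  proof
    assume "prefix p (H r)"
    then obtain e where "H r = p @ e" by (auto simp: prefix_def)
    then show ?thesis unfolding poss_def by (intro exI[of _ "e @ u"]) auto
  next
    assume *: "prefix p (H r') \<and> poss (Z r) u"
    then obtain t where "eqv u (Z r @ t)" by (auto simp: poss_def)
    then have "eqv (H r @ u) (H r' @ Z r' @ t)" using site_flip[OF clean pt] by blast
    then show ?thesis using * unfolding poss_def prefix_def by auto
  qed
qed

text \<open>Both words can be flipped at once, so \<open>t\<close> and \<open>s\<close> may be
  compared behind \<open>Z r\<close> or behind \<open>Z r'\<close>, and by \<open>zigzag\<close> one
  of the two suffices. If \<open>Z r\<close> is active, it is the coarser context by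
  \<open>active_imp\<close>; if it is inactive, \<open>inactive_imp\<close> favours
  \<open>Z r'\<close>.\<close>

lemma eqv_both_full:
  assumes pt: "ptn r r'"
  shows "eqv (r @ t) (r @ s) \<longleftrightarrow> (if inactive (Z r) t then eqv (Z r' @ t) (Z r' @ s) else eqv (Z r @ t) (Z r @ s))"
proof
  assume eq: "eqv (r @ t) (r @ s)"
  have clean: "clean r (H r @ Z r @ t)" using full_clean[of r t] pt partner_W by (metis HZ append.assoc)
  have "eqv (r @ t) (r' @ s)" using eq eqv_rel[OF pt] eqv_trans by blast
  then have "eqv (H r @ Z r @ t) (H r' @ Z r' @ s)" by (metis HZ append.assoc)
  then obtain t1 where t1: "eqv (Z r @ t) (Z r @ t1)" "eqv (Z r' @ s) (Z r' @ t1)"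
    using site_flip[OF clean pt] by blast
  have "eqv (Z r' @ t1) (Z r' @ s)" using t1 eqv_sym by blast
  from zigzag[OF pc_Z pc_Z t1(1) this]
  show "if inactive (Z r) t then eqv (Z r' @ t) (Z r' @ s) else eqv (Z r @ t) (Z r @ s)"
    using inactive_imp[of "Z r" t s "Z r'"] active_imp[OF pc_Z pc_Z, of r t r' s] by auto
next
  assume *: "if inactive (Z r) t then eqv (Z r' @ t) (Z r' @ s) else eqv (Z r @ t) (Z r @ s)"
  show "eqv (r @ t) (r @ s)"
  proof (cases "inactive (Z r) t")
    case True
    then have "eqv (H r' @ Z r' @ t) (H r' @ Z r' @ s)" using * eqv_left by auto
    then have "eqv (r' @ t) (r' @ s)" by (metis HZ append.assoc)
    then show ?thesis using eqv_rel[OF pt] eqv_rel[OF partner_sym[OF pt]] eqv_trans by blast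
  next
    case False
    then have "eqv (H r @ Z r @ t) (H r @ Z r @ s)" using * eqv_left by auto
    then show ?thesis by (metis HZ append.assoc)
  qed
qed

text \<open>Only a double flip could prevent cancellation. An inactive \<open>Z r\<close> would be a
  literal prefix of the rest, so for the word lacking this prefix the context \<open>Z r\<close> is
  active, hence coarsest, and the detour through \<open>Z r'\<close> gains nothing.\<close>

lemma eqv_not_both_full:
  assumes clean: "clean r (H r @ u)" and n: "\<not> (prefix (Z r) u \<and> prefix (Z r) v)"
  shows "eqv (H r @ u) (H r @ v) \<longleftrightarrow> eqv u v"
proof
  assume eq: "eqv (H r @ u) (H r @ v)"
  obtain r' where pt: "ptn r r'" using clean cleanD partner_ex by blast
  note lit = inactive_prefix[of "Z r"]
  from site_same[OF clean pt eq] show "eqv u v"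
  proof
    assume "\<exists>t t'. eqv u (Z r @ t) \<and> eqv v (Z r @ t') \<and> eqv (Z r' @ t) (Z r' @ t')"
    then obtain t t' where t: "eqv u (Z r @ t)" "eqv v (Z r @ t')" "eqv (Z r' @ t) (Z r' @ t')" by blast
    then consider "\<not> inactive (Z r) t" | "\<not> inactive (Z r) t'" using lit n by blast
    then have "eqv (Z r @ t) (Z r @ t')"
      by cases (use active_imp[OF pc_Z pc_Z] t eqv_sym in blast)+
    then show ?thesis using t eqv_sym eqv_trans by blast
  qed
qed (rule eqv_left)

lemma eqv_poss_same_full:
  assumes pt: "ptn r r'" and p: "pc p"
  shows "eqv_poss p (r @ t) (r @ s) \<longleftrightarrow> (prefix p (H r) \<or> prefix p (H r')) \<and>
    (if inactive (Z r) t then eqv_poss [] (Z r' @ t) (Z r' @ s) else eqv_poss [] (Z r @ t) (Z r @ s))"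
proof -
  have clean: "clean r (H r @ Z r @ t)" using full_clean[of r t] pt partner_W by (metis HZ append.assoc)
  have "poss (Z r) (Z r @ t)" unfolding poss_def by blast
  then have "poss p (H r @ Z r @ t) \<longleftrightarrow> prefix p (H r) \<or> prefix p (H r')"
    using poss_site[OF clean pt p] by blast
  then have "poss p (r @ t) \<longleftrightarrow> prefix p (H r) \<or> prefix p (H r')"
    by (metis HZ append.assoc)
  then show ?thesis unfolding eqv_poss_def eqv_both_full[OF pt] by auto
qed

lemma eqv_poss_same_not_full:
  assumes "clean r (H r @ u)" "ptn r r'" "pc p" "\<not> (prefix (Z r) u \<and> prefix (Z r) v)"
  shows "eqv_poss p (H r @ u) (H r @ v) \<longleftrightarrow>
    (if prefix p (H r) then eqv_poss [] u v else prefix p (H r') \<and> eqv_poss (Z r) u v)"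
  unfolding eqv_poss_def poss_site[OF assms(1-3)] eqv_not_both_full[OF assms(1,4)] by auto

lemma eqv_poss_flip:
  assumes "clean r (H r @ u)" "ptn r r'" "pc p"
  shows "eqv_poss p (H r @ u) (H r' @ v) \<longleftrightarrow> (prefix p (H r) \<or> prefix p (H r')) \<and> eqv (H r @ u) (H r' @ v)"
  unfolding eqv_poss_def poss_site[OF assms] site_flip[OF assms(1,2)] unfolding poss_def by blast

lemma eqv_flip_full_full:
  assumes "ptn r r'"
  shows "eqv (r @ t) (r' @ s) \<longleftrightarrow>
    (if inactive (Z r) t then eqv (Z r' @ t) (Z r' @ s) else eqv (Z r @ t) (Z r @ s))"
proof -
  have "eqv (r @ t) (r' @ s) \<longleftrightarrow> eqv (r @ t) (r @ s)"
    using eqv_rel[OF assms] eqv_rel[OF partner_sym[OF assms]] eqv_trans by blast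
  then show ?thesis using eqv_both_full[OF assms] by simp
qed

text \<open>The full relation word is flipped, after which both words start with \<open>H r'\<close>
  and it can be cancelled, since \<open>v\<close> lacks \<open>Z r'\<close>.\<close>

lemma eqv_flip_full_left:
  assumes "ptn r r'" "\<not> prefix (Z r') v"
  shows "eqv (H r @ Z r @ t) (H r' @ v) \<longleftrightarrow> eqv (Z r' @ t) v"
proof -
  have "clean r' (H r' @ Z r' @ t)" using full_clean[of r' t] assms partner_W by (metis HZ append.assoc)
  then have "eqv (H r' @ Z r' @ t) (H r' @ v) \<longleftrightarrow> eqv (Z r' @ t) v"
    using eqv_not_both_full assms by blast
  then show ?thesis using eqv_flip[OF assms(1), of t] eqv_sym eqv_trans by metis
qed

lemma eqv_flip_full_right:
  assumes "clean r (H r @ u)" "ptn r r'" "\<not> prefix (Z r) u"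
  shows "eqv (H r @ u) (H r' @ Z r' @ s) \<longleftrightarrow> eqv u (Z r @ s)"
proof -
  have "eqv (H r @ u) (H r @ Z r @ s) \<longleftrightarrow> eqv u (Z r @ s)"
    using eqv_not_both_full assms by blast
  then show ?thesis using eqv_flip[OF assms(2), of s] eqv_sym eqv_trans by metis
qed

text \<open>Neither rest has the literal prefix needed for a flip, so \<open>Z r\<close> and
  \<open>Z r'\<close> are both active before the common \<open>t\<close>. By
  \<open>active_common\<close> the site starts in a common suffix \<open>b\<close> of both, and by
  maximality \<open>b\<close> is a suffix of \<open>z\<close>. What precedes \<open>b\<close> is
  untouched, which forces \<open>z1\<close> and \<open>z1'\<close> literally; \<open>z\<close>
  itself only has to be a possible prefix.\<close>

lemma eqv_flip_not_full:
  assumes clean: "clean r (H r @ u)" and pt: "ptn r r'"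
    and n: "\<not> prefix (Z r) u" "\<not> prefix (Z r') v"
    and z: "Z r = z1 @ z" "Z r' = z1' @ z"
    and max: "\<And>a a' b. Z r = a @ b \<Longrightarrow> Z r' = a' @ b \<Longrightarrow> suffix b z"
  shows "eqv (H r @ u) (H r' @ v) \<longleftrightarrow> (\<exists>u1 v1. u = z1 @ u1 \<and> v = z1' @ v1 \<and> eqv_poss z u1 v1)"
proof
  assume "eqv (H r @ u) (H r' @ v)"
  then obtain t where t: "eqv u (Z r @ t)" "eqv v (Z r' @ t)" using site_flip[OF clean pt] by blast
  have "\<not> inactive (Z r) t" "\<not> inactive (Z r') t"
    using n t inactive_prefix by blast+
  then obtain a a' b where *: "Z r = a @ b" "Z r' = a' @ b" "inactive a (b @ t)" "inactive a' (b @ t)"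
    using active_common[OF pc_Z pc_Z] by metis
  obtain u0 where u0: "u = a @ u0" "eqv (b @ t) u0"
    using eqv_strip[OF *(3)] t * eqv_sym by (metis append.assoc)
  obtain v0 where v0: "v = a' @ v0" "eqv (b @ t) v0"
    using eqv_strip[OF *(4)] t * eqv_sym by (metis append.assoc)
  obtain e where e: "z = e @ b" using max[OF *(1,2)] by (auto simp: suffix_def)
  then have a: "a = z1 @ e" "a' = z1' @ e" using z * by auto
  have "eqv (e @ u0) (e @ v0)" "eqv (e @ u0) (z @ t)"
    using u0 v0 e eqv_left eqv_sym eqv_trans by (metis, metis append.assoc)
  then have "eqv_poss z (e @ u0) (e @ v0)" unfolding eqv_poss_def poss_def by blast
  then show "\<exists>u1 v1. u = z1 @ u1 \<and> v = z1' @ v1 \<and> eqv_poss z u1 v1"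
    using u0 v0 a by auto
next
  assume "\<exists>u1 v1. u = z1 @ u1 \<and> v = z1' @ v1 \<and> eqv_poss z u1 v1"
  then obtain u1 v1 t where *: "u = z1 @ u1" "v = z1' @ v1" "eqv u1 v1" "eqv u1 (z @ t)"
    unfolding eqv_poss_def poss_def by blast
  then have "eqv v1 (z @ t)" using eqv_sym eqv_trans by blast
  then have "eqv u (Z r @ t)" "eqv v (Z r' @ t)" using * z eqv_left by auto
  then show "eqv (H r @ u) (H r' @ v)" using site_flip[OF clean pt] by blast
qed

lemma eqv_poss_site_shape:
  assumes "clean r (H r @ u)" "ptn r r'" "eqv_poss p (H r @ u) v"
  shows "prefix (H r) v \<or> prefix (H r') v"
  using site_shape assms unfolding eqv_poss_def by blast

end


section \<open>A decision procedure with bounded lookahead\<close>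

lemma longest_common_suffix:
  obtains z x y where "a = x @ z" "b = y @ z"
    "\<And>x' y' w. a = x' @ w \<Longrightarrow> b = y' @ w \<Longrightarrow> suffix w z"
proof -
  define z where "z = rev (longest_common_prefix (rev a) (rev b))"
  have "suffix z a" "suffix z b"
    unfolding z_def suffix_to_prefix
    by (simp_all add: longest_common_prefix_prefix1 longest_common_prefix_prefix2)
  moreover have "suffix w z" if "a = x' @ w" "b = y' @ w" for x' y' w
    using that unfolding z_def suffix_to_prefix by (simp add: longest_common_prefix_max_prefix)
  ultimately show ?thesis using that unfolding suffix_def by metis
qed

lemma prefix_extend: "e = [] \<or> length s \<le> length u \<Longrightarrow> prefix s (u @ e) \<longleftrightarrow> prefix s u"
  by (auto simp: prefix_append)

datatype 'a verdict = Ans bool | Next "'a list" nat "'a list" nat "'a list"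

locale C4_bounded = C4 R for R :: "('a list \<times> 'a list) set" +
  fixes n :: nat
  assumes bound: "r \<in> relation_words R \<Longrightarrow> length r \<le> n"
begin

text \<open>After a full relation word of length at most \<open>n\<close>, deciding
  \<open>inactive\<close> takes another \<open>2 * n\<close> letters: one \<open>H r\<close> and the
  room for a further \<open>H s\<close> starting inside it. The summand 1 keeps \<open>L\<close>
  positive even if \<open>n = 0\<close>.\<close>

definition "L = 3 * n + 1"

text \<open>Here \<open>e\<close> is the unread rest behind the known part \<open>u\<close>. A known
  part shorter than \<open>L\<close> is the entire word.\<close>

definition ext :: "'a list \<Rightarrow> 'a list \<Rightarrow> bool" where
  "ext u e \<longleftrightarrow> e = [] \<or> L \<le> length u"

lemma H_bound: "r \<in> W \<Longrightarrow> length (H r) \<le> n"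
  using bound[of r] HZ[of r] by (metis le_add1 le_trans length_append)

lemma Z_bound: "r \<in> W \<Longrightarrow> length (Z r) \<le> n"
  using bound[of r] HZ[of r] by (metis le_add2 le_trans length_append)

lemma piece_bound:
  assumes "pc p" shows "length p \<le> n"
proof -
  have "p = [] \<or> (\<exists>w\<in>W. sublist p w)"
    using assms unfolding piece_def factor_of_side_def relation_words_def occurs_twice_def
    by (auto simp: sublist_def)
  then show ?thesis using bound sublist_length_le[of p] by fastforce
qed

lemma clean_extend:
  assumes "e = [] \<or> 2 * n \<le> length u"
  shows "clean r (u @ e) \<longleftrightarrow> clean r u"
proof (cases "e = []")
  case False
  then have len: "2 * n \<le> length u" using assms by simp
  show ?thesis
  proof (cases "r \<in> W \<and> prefix (H r) u")
    case True
    then obtain w' where w': "u = H r @ w'" by (auto simp: prefix_def)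
    have "length (H s) \<le> length (y @ w')" if "s \<in> W" for s y
      using H_bound[OF that] H_bound[of r] True len w' by simp
    then have "prefix (H s) ((y @ w') @ e) \<longleftrightarrow> prefix (H s) (y @ w')" if "s \<in> W" for s y
      using that prefix_extend by blast
    then show ?thesis unfolding clean_def using w' by auto
  next
    case F: False
    have "\<not> clean r u" using F cleanD by blast
    moreover have "\<not> clean r (u @ e)"
    proof
      assume "clean r (u @ e)"
      then have "r \<in> W" "prefix (H r) (u @ e)" using cleanD by blast+
      moreover have "length (H r) \<le> length u" using H_bound[OF calculation(1)] len by simp
      ultimately show False using F prefix_extend by blast
    qed
    ultimately show ?thesis by blast
  qed
qed simp

lemma inactive_extend:
  assumes "e = [] \<or> 2 * n \<le> length t"
  shows "inactive z (t @ e) \<longleftrightarrow> inactive z t"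
proof -
  have "clean r ((a @ t) @ e) \<longleftrightarrow> clean r (a @ t)" for r a
    using clean_extend[of e "a @ t" r] assms by auto
  then show ?thesis unfolding inactive_def by auto
qed

definition decided :: "'a list \<Rightarrow> 'a list \<Rightarrow> 'a list \<Rightarrow> bool \<Rightarrow> bool" where
  "decided p u v b \<longleftrightarrow> (\<forall>e e'. ext u e \<longrightarrow> ext v e' \<longrightarrow> eqv_poss p (u @ e) (v @ e') = b)"

definition reduced :: "'a list \<Rightarrow> 'a list \<Rightarrow> 'a list \<Rightarrow> 'a list \<Rightarrow> 'a list \<Rightarrow> 'a list \<Rightarrow> bool" where
  "reduced p u v p' u' v' \<longleftrightarrow>
    (\<forall>e e'. ext u e \<longrightarrow> ext v e' \<longrightarrow> eqv_poss p (u @ e) (v @ e') = eqv_poss p' (u' @ e) (v' @ e'))"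

text \<open>A piece contains no \<open>H r\<close>, so removing such a prefix uses up the stored
  piece and at least one letter behind it. This is what turns a reduction into progress.\<close>

definition long :: "'a list \<Rightarrow> bool" where
  "long a \<longleftrightarrow> (\<exists>r\<in>W. prefix (H r) a)"

definition step_ok :: "'a list \<Rightarrow> 'a list \<Rightarrow> 'a list \<Rightarrow> bool" where
  "step_ok p u v \<longleftrightarrow> (\<exists>b. decided p u v b) \<or>
    (\<exists>x u' v'. u = x # u' \<and> v = x # v' \<and> reduced p u v (tl p) u' v') \<or>
    (\<exists>a b c d u' v' p'. long a \<and> long b \<and> u = a @ u' \<and> v = b @ v' \<and> pc c \<and> pc d \<and> pc p' \<and>
      reduced p u v p' (c @ u') (d @ v'))"

lemma step_okI1: "decided p u v b \<Longrightarrow> step_ok p u v"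
  unfolding step_ok_def by blast

lemma step_okI2:
  "\<lbrakk>u = a @ u'; v = b @ v'; reduced p u v p' (c @ u') (d @ v'); long a; long b; pc c; pc d; pc p'\<rbrakk>
    \<Longrightarrow> step_ok p u v"
  unfolding step_ok_def by blast

lemma prefix_ext: "ext u e \<Longrightarrow> length s \<le> n \<Longrightarrow> prefix s (u @ e) \<longleftrightarrow> prefix s u"
  by (rule prefix_extend) (auto simp: ext_def L_def)

lemma clean_ext: "ext u e \<Longrightarrow> clean r (u @ e) \<longleftrightarrow> clean r u"
  by (rule clean_extend) (auto simp: ext_def L_def)

lemma prefix_ext_H:
  assumes "ext (H r @ u) e" "r \<in> W" "length s \<le> n"
  shows "prefix s (u @ e) \<longleftrightarrow> prefix s u"
  using prefix_extend[of e s u] H_bound[OF assms(2)] assms(1,3) by (auto simp: ext_def L_def)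

lemma inactive_ext:
  assumes "ext (r @ t) e" "r \<in> W"
  shows "inactive z (t @ e) \<longleftrightarrow> inactive z t"
  using inactive_extend[of e t z] bound[OF assms(2)] assms(1) by (auto simp: ext_def L_def)

lemma long_H: "r \<in> W \<Longrightarrow> long (H r @ x)"
  unfolding long_def by (meson prefixI)

lemma long_full: "r \<in> W \<Longrightarrow> long r"
  using long_H[of r "Z r"] by simp

section \<open>One reduction step that depends only on known prefixes\<close>

lemma word_step_inactive:
  assumes "\<nexists>r. clean r u"
  shows "step_ok p u v"
proof (cases u)
  case Nil
  then have "decided p u v (p = [] \<and> v = [])"
    unfolding decided_def ext_def L_def by (auto simp: eqv_poss_empty)
  then show ?thesis by (rule step_okI1)
next
  case (Cons x u')
  have d: "eqv_poss p (u @ e) w \<longleftrightarrow> (p = [] \<or> hd p = x) \<and> (\<exists>v'. w = x # v' \<and> eqv_poss (tl p) (u' @ e) v')"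
    if "ext u e" for e w
    using eqv_poss_letter[of x "u' @ e" p w] clean_ext[OF that] assms Cons by simp
  show ?thesis
  proof (cases "(p = [] \<or> hd p = x) \<and> (\<exists>v'. v = x # v')")
    case True
    then obtain v' where v: "v = x # v'" by blast
    then have "reduced p u v (tl p) u' v'" unfolding reduced_def using d True by auto
    then show ?thesis unfolding step_ok_def using Cons v by blast
  next
    case False
    \<comment> \<open>Since \<open>L\<close> is positive, an empty known part has no rest behind
      it.\<close>
    moreover have "\<exists>v''. v = x # v''" if "ext v e'" "v @ e' = x # v'" for e' v'
      using that by (cases v) (auto simp: ext_def L_def)
    ultimately have "\<not> eqv_poss p (u @ e) (v @ e')" if "ext u e" "ext v e'" for e e'
      using d[OF that(1), of "v @ e'"] that(2) False by metis
    then have "decided p u v False" unfolding decided_def by simp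
    then show ?thesis by (rule step_okI1)
  qed
qed

lemma word_step_same:
  assumes clean: "clean r (H r @ u)" and pt: "ptn r r'" and p: "pc p"
  shows "step_ok p (H r @ u) (H r @ v)"
proof -
  have W: "r \<in> W" "r' \<in> W" using pt partner_W by blast+
  note lH = long_H[OF W(1), of "[]", simplified]
  show ?thesis
  proof (cases "prefix (Z r) u \<and> prefix (Z r) v")
    case True
    then obtain t s where ts: "u = Z r @ t" "v = Z r @ s" by (auto simp: prefix_def)
    then have eq: "H r @ u = r @ t" "H r @ v = r @ s" using HZ by (metis append.assoc)+
    have d: "eqv_poss p ((r @ t) @ e) ((r @ s) @ e') \<longleftrightarrow> (prefix p (H r) \<or> prefix p (H r')) \<and>
      (if inactive (Z r) t then eqv_poss [] (Z r' @ t @ e) (Z r' @ s @ e') else eqv_poss [] (Z r @ t @ e) (Z r @ s @ e'))"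
      if "ext (r @ t) e" for e e'
      using eqv_poss_same_full[OF pt p, of "t @ e" "s @ e'"] inactive_ext[OF that W(1)] by simp
    consider "\<not> (prefix p (H r) \<or> prefix p (H r'))" | "prefix p (H r) \<or> prefix p (H r')" "inactive (Z r) t"
      | "prefix p (H r) \<or> prefix p (H r')" "\<not> inactive (Z r) t" by blast
    then show ?thesis
    proof cases
      case 1
      then have "decided p (r @ t) (r @ s) False" unfolding decided_def using d by blast
      then show ?thesis unfolding eq by (rule step_okI1)
    next
      case 2
      then have "reduced p (r @ t) (r @ s) [] (Z r' @ t) (Z r' @ s)" unfolding reduced_def using d by simp
      then show ?thesis unfolding eq
        by (rule step_okI2[OF HOL.refl HOL.refl]) (auto simp: long_full W pc_Z)
    next
      case 3
      then have "reduced p (r @ t) (r @ s) [] (Z r @ t) (Z r @ s)" unfolding reduced_def using d by simp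
      then show ?thesis unfolding eq
        by (rule step_okI2[OF HOL.refl HOL.refl]) (auto simp: long_full W pc_Z)
    qed
  next
    case False
    have d: "eqv_poss p ((H r @ u) @ e) ((H r @ v) @ e') \<longleftrightarrow>
      (if prefix p (H r) then eqv_poss [] (u @ e) (v @ e') else prefix p (H r') \<and> eqv_poss (Z r) (u @ e) (v @ e'))"
      if e: "ext (H r @ u) e" "ext (H r @ v) e'" for e e'
    proof -
      have "\<not> (prefix (Z r) (u @ e) \<and> prefix (Z r) (v @ e'))"
        using False prefix_ext_H[OF e(1) W(1) Z_bound[OF W(1)]] prefix_ext_H[OF e(2) W(1) Z_bound[OF W(1)]]
        by blast
      moreover have "clean r (H r @ u @ e)" using clean_ext[OF e(1)] clean by simp
      ultimately show ?thesis using eqv_poss_same_not_full[OF _ pt p] by simp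
    qed
    consider "prefix p (H r)" | "\<not> prefix p (H r)" "prefix p (H r')"
      | "\<not> prefix p (H r)" "\<not> prefix p (H r')" by blast
    then show ?thesis
    proof cases
      case 1
      then have "reduced p (H r @ u) (H r @ v) [] ([] @ u) ([] @ v)" unfolding reduced_def using d by simp
      then show ?thesis
        by (rule step_okI2[OF HOL.refl HOL.refl]) (auto simp: lH)
    next
      case 2
      then have "reduced p (H r @ u) (H r @ v) (Z r) ([] @ u) ([] @ v)" unfolding reduced_def using d by simp
      then show ?thesis
        by (rule step_okI2[OF HOL.refl HOL.refl]) (auto simp: lH pc_Z)
    next
      case 3
      then have "decided p (H r @ u) (H r @ v) False" unfolding decided_def using d by simp
      then show ?thesis by (rule step_okI1)
    qed
  qed
qed

lemma word_step_flip:
  assumes clean: "clean r (H r @ u)" and pt: "ptn r r'" and p: "pc p"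
  shows "step_ok p (H r @ u) (H r' @ v)"
proof (cases "prefix p (H r) \<or> prefix p (H r')")
  case False
  have "\<not> eqv_poss p ((H r @ u) @ e) ((H r' @ v) @ e')" if "ext (H r @ u) e" for e e'
    using eqv_poss_flip[OF _ pt p, of "u @ e" "v @ e'"] clean_ext[OF that] clean False by simp
  then have "decided p (H r @ u) (H r' @ v) False" unfolding decided_def by blast
  then show ?thesis by (rule step_okI1)
next
  case True
  have W: "r \<in> W" "r' \<in> W" using pt partner_W by blast+
  note lH = long_H[OF W(1), of "[]", simplified] long_H[OF W(2), of "[]", simplified]
  note Zb = Z_bound[OF W(1)] Z_bound[OF W(2)]
  have d: "eqv_poss p ((H r @ u) @ e) ((H r' @ v) @ e') \<longleftrightarrow> eqv (H r @ u @ e) (H r' @ v @ e')"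
    if "ext (H r @ u) e" for e e'
    using eqv_poss_flip[OF _ pt p, of "u @ e" "v @ e'"] clean_ext[OF that] clean True by simp
  have clean_e: "clean r (H r @ u @ e)" if "ext (H r @ u) e" for e
    using clean_ext[OF that] clean by simp
  consider (both) t s where "u = Z r @ t" "v = Z r' @ s"
    | (left) t where "u = Z r @ t" "\<not> prefix (Z r') v"
    | (right) s where "v = Z r' @ s" "\<not> prefix (Z r) u"
    | (none) "\<not> prefix (Z r) u" "\<not> prefix (Z r') v"
    by (cases "prefix (Z r) u"; cases "prefix (Z r') v") (auto elim!: prefixE)
  then show ?thesis
  proof cases
    case both
    then have eq: "H r @ u = r @ t" "H r' @ v = r' @ s" using HZ by (metis append.assoc)+
    have d': "eqv_poss p ((r @ t) @ e) ((r' @ s) @ e') \<longleftrightarrow>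
      (if inactive (Z r) t then eqv_poss [] (Z r' @ t @ e) (Z r' @ s @ e') else eqv_poss [] (Z r @ t @ e) (Z r @ s @ e'))"
      if "ext (r @ t) e" for e e'
    proof -
      have "eqv_poss p ((r @ t) @ e) ((r' @ s) @ e') \<longleftrightarrow> eqv (r @ t @ e) (r' @ s @ e')"
        using d[of e e'] that unfolding eq by (metis append.assoc eq)
      then show ?thesis
        using eqv_flip_full_full[OF pt, of "t @ e" "s @ e'"] inactive_ext[OF that W(1)] by (simp add: eqv_poss_Nil)
    qed
    show ?thesis
    proof (cases "inactive (Z r) t")
      case True
      then have "reduced p (r @ t) (r' @ s) [] (Z r' @ t) (Z r' @ s)" unfolding reduced_def using d' by simp
      then show ?thesis unfolding eq
        by (rule step_okI2[OF HOL.refl HOL.refl]) (auto simp: long_full W pc_Z)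
    next
      case False
      then have "reduced p (r @ t) (r' @ s) [] (Z r @ t) (Z r @ s)" unfolding reduced_def using d' by simp
      then show ?thesis unfolding eq
        by (rule step_okI2[OF HOL.refl HOL.refl]) (auto simp: long_full W pc_Z)
    qed
  next
    case left
    have "reduced p (H r @ u) (H r' @ v) [] (Z r' @ t) ([] @ v)"
      unfolding reduced_def
    proof (intro allI impI)
      fix e e' assume e: "ext (H r @ u) e" "ext (H r' @ v) e'"
      have "\<not> prefix (Z r') (v @ e')" using prefix_ext_H[OF e(2) W(2) Zb(2)] left by simp
      then show "eqv_poss p ((H r @ u) @ e) ((H r' @ v) @ e') = eqv_poss [] ((Z r' @ t) @ e) (([] @ v) @ e')"
        using d[OF e(1)] eqv_flip_full_left[OF pt, of "v @ e'" "t @ e"] left by (simp add: eqv_poss_Nil)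
    qed
    moreover have "H r @ u = r @ t" using left HZ by (metis append.assoc)
    ultimately show ?thesis
      by (intro step_okI2[of _ r t _ "H r'" v _ "[]" "Z r'" "[]"]) (auto simp: long_full lH W pc_Z)
  next
    case right
    have "reduced p (H r @ u) (H r' @ v) [] ([] @ u) (Z r @ s)"
      unfolding reduced_def
    proof (intro allI impI)
      fix e e' assume e: "ext (H r @ u) e" "ext (H r' @ v) e'"
      have "\<not> prefix (Z r) (u @ e)" using prefix_ext_H[OF e(1) W(1) Zb(1)] right by simp
      then show "eqv_poss p ((H r @ u) @ e) ((H r' @ v) @ e') = eqv_poss [] (([] @ u) @ e) ((Z r @ s) @ e')"
        using d[OF e(1)] eqv_flip_full_right[OF clean_e[OF e(1)] pt, of "s @ e'"] right by (simp add: eqv_poss_Nil)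
    qed
    moreover have "H r' @ v = r' @ s" using right HZ by (metis append.assoc)
    ultimately show ?thesis
      by (intro step_okI2[of _ "H r" u _ r' s _ "[]" "[]" "Z r"]) (auto simp: long_full lH W pc_Z)
  next
    case none
    obtain z z1 z2 where z: "Z r = z1 @ z" "Z r' = z2 @ z"
      "\<And>x' y' w. Z r = x' @ w \<Longrightarrow> Z r' = y' @ w \<Longrightarrow> suffix w z"
      using longest_common_suffix by metis
    have zb: "length z1 \<le> n" "length z2 \<le> n" using Zb z by auto
    have "pc z" using piece_sublist[OF pc_Z[of r], of z] z(1) by simp
    have d': "eqv_poss p ((H r @ u) @ e) ((H r' @ v) @ e') \<longleftrightarrow>
        (\<exists>u1 v1. u @ e = z1 @ u1 \<and> v @ e' = z2 @ v1 \<and> eqv_poss z u1 v1)"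
      if e: "ext (H r @ u) e" "ext (H r' @ v) e'" for e e'
    proof -
      have "\<not> prefix (Z r) (u @ e)" "\<not> prefix (Z r') (v @ e')"
        using prefix_ext_H[OF e(1) W(1) Zb(1)] prefix_ext_H[OF e(2) W(2) Zb(2)] none by auto
      from eqv_flip_not_full[OF clean_e[OF e(1)] pt this z]
      show ?thesis using d[OF e(1)] by simp
    qed
    show ?thesis
    proof (cases "prefix z1 u \<and> prefix z2 v")
      case True
      then obtain u1 v1 where uv: "u = z1 @ u1" "v = z2 @ v1" by (auto simp: prefix_def)
      have "reduced p (H r @ u) (H r' @ v) z ([] @ u1) ([] @ v1)"
        unfolding reduced_def using d' uv by simp
      then show ?thesis
        by (intro step_okI2[of _ "H r @ z1" u1 _ "H r' @ z2" v1 _ z "[]" "[]"])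
          (auto simp: uv long_H W \<open>pc z\<close>)
    next
      case False
      have "decided p (H r @ u) (H r' @ v) False"
        unfolding decided_def
      proof (intro allI impI)
        fix e e' assume e: "ext (H r @ u) e" "ext (H r' @ v) e'"
        have "\<not> (prefix z1 (u @ e) \<and> prefix z2 (v @ e'))"
          using prefix_ext_H[OF e(1) W(1) zb(1)] prefix_ext_H[OF e(2) W(2) zb(2)] False by simp
        then show "eqv_poss p ((H r @ u) @ e) ((H r' @ v) @ e') = False"
          using d'[OF e] by (metis prefixI)
      qed
      then show ?thesis by (rule step_okI1)
    qed
  qed
qed

lemma word_step:
  assumes p: "pc p"
  shows "step_ok p u v"
proof (cases "\<exists>r. clean r u")
  case False
  then show ?thesis using word_step_inactive by blast
next
  case True
  then obtain r u' where r: "clean r u" "u = H r @ u'" unfolding clean_def by blast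
  obtain r' where pt: "ptn r r'" using r cleanD partner_ex by blast
  have W: "r \<in> W" "r' \<in> W" using pt partner_W by blast+
  consider v' where "v = H r @ v'" | v' where "v = H r' @ v'" | "\<not> prefix (H r) v" "\<not> prefix (H r') v"
    by (auto simp: prefix_def)
  then show ?thesis
  proof cases
    case 1 then show ?thesis using word_step_same r pt p by blast
  next
    case 2 then show ?thesis using word_step_flip r pt p by blast
  next
    case 3
    have "decided p u v False"
      unfolding decided_def
    proof (intro allI impI)
      fix e e' assume e: "ext u e" "ext v e'"
      have "\<not> prefix (H r) (v @ e')" "\<not> prefix (H r') (v @ e')"
        using 3 prefix_ext[OF e(2)] H_bound W by auto
      moreover have "clean r (H r @ u' @ e)" using clean_ext[OF e(1)] r by simp
      ultimately show "eqv_poss p (u @ e) (v @ e') = False" using eqv_poss_site_shape[OF _ pt] r by auto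
    qed
    then show ?thesis by (rule step_okI1)
  qed
qed

text \<open>The words under comparison are \<open>c @ u\<close> and \<open>d @ v\<close>, where the pieces \<open>c\<close> and \<open>d\<close>
  are kept in memory and only the prefixes \<open>x\<close> of \<open>u\<close> and \<open>y\<close> of \<open>v\<close> are known. The clause
  \<open>0 < l \<or> length d' < length d\<close> guarantees progress in the second word.\<close>

fun correct :: "'a list \<Rightarrow> 'a list \<Rightarrow> 'a list \<Rightarrow> 'a list \<Rightarrow> 'a list \<Rightarrow> 'a verdict \<Rightarrow> bool" where
  "correct c d p x y (Ans b) \<longleftrightarrow>
    (\<forall>e e'. ext x e \<longrightarrow> ext y e' \<longrightarrow> eqv_poss p (c @ x @ e) (d @ y @ e') = b)"
| "correct c d p x y (Next c' k d' l p') \<longleftrightarrow>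
    pc c' \<and> pc d' \<and> pc p' \<and> k \<le> length x \<and> l \<le> length y \<and> (0 < l \<or> length d' < length d) \<and>
    (\<forall>e e'. ext x e \<longrightarrow> ext y e' \<longrightarrow>
      eqv_poss p (c @ x @ e) (d @ y @ e') = eqv_poss p' (c' @ drop k x @ e) (d' @ drop l y @ e'))"

lemma ext_append: "ext x e \<Longrightarrow> ext (c @ x) e"
  by (auto simp: ext_def)

lemma long_split:
  assumes "pc c" "long a" "c @ x = a @ u'"
  shows "\<exists>k. 0 < k \<and> k \<le> length x \<and> u' = drop k x"
proof -
  obtain r where r: "r \<in> W" "prefix (H r) a" using assms(2) unfolding long_def by blast
  have "\<not> prefix a c"
  proof
    assume "prefix a c"
    then have "prefix (H r) c" using r prefix_order.order_trans by blast
    then show False using assms(1) r piece_sublist H_not_piece by blast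
  qed
  then obtain e where e: "a = c @ e" "e \<noteq> []"
    using assms(3) by (metis append.right_neutral prefix_def prefix_order.order_refl prefixI prefix_same_cases)
  then have "x = e @ u'" using assms(3) by simp
  then show ?thesis using e by (intro exI[of _ "length e"]) auto
qed

lemma letter_split:
  assumes "pc c" "c @ x = a # u'"
  shows "\<exists>c' k. pc c' \<and> k \<le> length x \<and> (0 < k \<or> length c' < length c) \<and> u' = c' @ drop k x"
proof (cases c)
  case Nil
  then show ?thesis using assms by (intro exI[of _ "[]"] exI[of _ 1]) auto
next
  case (Cons y c')
  then have "pc c'" using assms(1) piece_sublist by (metis sublist_Cons_right sublist_order.order_refl)
  then show ?thesis using assms Cons by (intro exI[of _ c'] exI[of _ 0]) auto
qed

lemma verdict_exists:
  assumes "pc c" "pc d" "pc p"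
  shows "\<exists>g. correct c d p x y g"
proof -
  from word_step[OF assms(3), of "c @ x" "d @ y"] consider
    b where "decided p (c @ x) (d @ y) b"
    | a u' v' where "c @ x = a # u'" "d @ y = a # v'" "reduced p (c @ x) (d @ y) (tl p) u' v'"
    | a b c' d' u' v' p' where "long a" "long b" "c @ x = a @ u'" "d @ y = b @ v'" "pc c'" "pc d'" "pc p'"
        "reduced p (c @ x) (d @ y) p' (c' @ u') (d' @ v')"
    unfolding step_ok_def by blast
  then show ?thesis
  proof cases
    case 1
    then have "correct c d p x y (Ans b)"
      unfolding decided_def using ext_append by fastforce
    then show ?thesis by blast
  next
    case 2
    obtain c' k where c': "pc c'" "k \<le> length x" "u' = c' @ drop k x"
      using letter_split[OF assms(1) 2(1)] by blast
    obtain d' l where d': "pc d'" "l \<le> length y" "0 < l \<or> length d' < length d" "v' = d' @ drop l y"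
      using letter_split[OF assms(2) 2(2)] by blast
    have "pc (tl p)" using assms(3) piece_sublist by (metis sublist_tl)
    then have "correct c d p x y (Next c' k d' l (tl p))"
      using c' d' 2(3) unfolding reduced_def using ext_append by fastforce
    then show ?thesis by blast
  next
    case 3
    obtain k where k: "k \<le> length x" "u' = drop k x"
      using long_split[OF assms(1) 3(1,3)] by blast
    obtain l where l: "0 < l" "l \<le> length y" "v' = drop l y"
      using long_split[OF assms(2) 3(2,4)] by blast
    have "eqv_poss p (c @ x @ e) (d @ y @ e') = eqv_poss p' (c' @ drop k x @ e) (d' @ drop l y @ e')"
      if "ext x e" "ext y e'" for e e'
      using 3(8)[unfolded reduced_def, rule_format, OF ext_append[OF that(1), of c] ext_append[OF that(2), of d]]
      by (simp add: k(2) l(3))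
    then have "correct c d p x y (Next c' k d' l p')"
      using k(1) l(1,2) 3 by simp
    then show ?thesis by blast
  qed
qed

end


section \<open>A two-tape automaton for the word problem\<close>

text \<open>An automaton sees the next letter of each word, or \<open>None\<close> at its end, and decides for each
  word whether to move on.\<close>

type_synonym ('q, 'a) automaton = "'q \<Rightarrow> 'a option \<Rightarrow> 'a option \<Rightarrow> 'q \<times> bool \<times> bool"

definition next_letter :: "'a list \<Rightarrow> 'a option" where
  "next_letter w = (case w of [] \<Rightarrow> None | a # _ \<Rightarrow> Some a)"

inductive halts :: "('q, 'a) automaton \<Rightarrow> ('q \<Rightarrow> bool option) \<Rightarrow> nat \<Rightarrow> 'q \<Rightarrow> 'a list \<Rightarrow> 'a list \<Rightarrow> bool \<Rightarrow> bool"
  for \<delta> out where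
  halted: "out q = Some b \<Longrightarrow> halts \<delta> out 0 q u v b"
| move: "\<lbrakk>out q = None; \<delta> q (next_letter u) (next_letter v) = (q', m, m');
    halts \<delta> out k q' (if m then tl u else u) (if m' then tl v else v) b\<rbrakk>
    \<Longrightarrow> halts \<delta> out (Suc k) q u v b"

definition decides :: "'a set \<Rightarrow> 'q set \<Rightarrow> ('q, 'a) automaton \<Rightarrow> ('q \<Rightarrow> bool option) \<Rightarrow> 'q
    \<Rightarrow> nat \<Rightarrow> nat \<Rightarrow> ('a list \<Rightarrow> 'a list \<Rightarrow> bool) \<Rightarrow> bool" where
  "decides A Q \<delta> out q0 c d P \<longleftrightarrow> finite Q \<and> q0 \<in> Q \<and>
    (\<forall>q\<in>Q. \<forall>o1\<in>insert None (Some ` A). \<forall>o2\<in>insert None (Some ` A). fst (\<delta> q o1 o2) \<in> Q) \<and>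
    (\<forall>u\<in>lists A. \<forall>v\<in>lists A. \<exists>k \<le> c * length v + d. halts \<delta> out k q0 u v (P u v))"

lemma decides_cong:
  assumes "\<And>u v. u \<in> lists A \<Longrightarrow> P u v \<longleftrightarrow> P' u v"
  shows "decides A Q \<delta> out q0 c d P \<longleftrightarrow> decides A Q \<delta> out q0 c d P'"
  unfolding decides_def by (intro conj_cong ball_cong HOL.refl) (simp only: assms)

text \<open>In \<open>Work c d p x eu y ev\<close>, the words \<open>x\<close> and \<open>y\<close> have been read ahead, and \<open>eu\<close> and \<open>ev\<close>
  record that the end of the respective word has been seen.\<close>

datatype 'a control =
  Work "'a list" "'a list" "'a list" "'a list" bool "'a list" bool | Done bool

fun verdict_of :: "'a control \<Rightarrow> bool option" where
  "verdict_of (Done b) = Some b"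
| "verdict_of _ = None"

context C4_bounded
begin

text \<open>Only finitely many pieces and words of length at most \<open>L\<close> over the alphabet
  occur as arguments, so the chosen verdicts amount to a finite table built into the
  automaton.\<close>

definition "next_verdict c d p x y = (SOME g. correct c d p x y g)"

lemma correct_next_verdict: "pc c \<Longrightarrow> pc d \<Longrightarrow> pc p \<Longrightarrow> correct c d p x y (next_verdict c d p x y)"
  unfolding next_verdict_def by (rule someI_ex) (rule verdict_exists)

fun aut :: "('a control, 'a) automaton" where
  "aut (Done b) o1 o2 = (Done b, False, False)"
| "aut (Work c d p x eu y ev) o1 o2 =
    (if length x < L \<and> \<not> eu then
       (case o1 of None \<Rightarrow> (Work c d p x True y ev, False, False)
        | Some a \<Rightarrow> (Work c d p (x @ [a]) eu y ev, True, False))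
     else if length y < L \<and> \<not> ev then
       (case o2 of None \<Rightarrow> (Work c d p x eu y True, False, False)
        | Some a \<Rightarrow> (Work c d p x eu (y @ [a]) ev, False, True))
     else (case next_verdict c d p x y of Ans b \<Rightarrow> (Done b, False, False)
        | Next c' k d' l p' \<Rightarrow> (Work c' d' p' (drop k x) eu (drop l y) ev, False, False)))"

text \<open>A potential that does not mention the first word. The first factor drops with every
  verdict: a consumed letter of the second word releases \<open>n + 1\<close>, more than the length
  of the new stored piece, and otherwise the stored piece shrinks. The factor
  \<open>2 * L + 3\<close> pays for refilling both buffers, noticing both ends and issuing the
  verdict.\<close>

definition budget :: "'a list \<Rightarrow> nat \<Rightarrow> nat" where
  "budget d m = ((n + 1) * m + length d) * (2 * L + 3)"

definition reads :: "'a list \<Rightarrow> bool \<Rightarrow> 'a list \<Rightarrow> bool \<Rightarrow> nat" where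
  "reads x eu y ev = (L - length x) + (L - length y) + of_bool (\<not> eu) + of_bool (\<not> ev) + 1"

definition weight :: "'a list \<Rightarrow> 'a list \<Rightarrow> bool \<Rightarrow> 'a list \<Rightarrow> bool \<Rightarrow> 'a list \<Rightarrow> nat" where
  "weight d x eu y ev v = budget d (length y + length v) + reads x eu y ev"

lemma weight_Next:
  assumes "l \<le> length y" "0 < l \<or> length d' < length d" "length d' \<le> n"
  shows "weight d' x' eu (drop l y) ev v < weight d x eu y ev v"
proof -
  have "(n + 1) * (length (drop l y) + length v) + length d' < (n + 1) * (length y + length v) + length d"
  proof (cases "l = 0")
    case False
    have e: "length y + length v = (length (drop l y) + length v) + l" using assms(1) by simp
    have "(n + 1) * 1 \<le> (n + 1) * l" using False by (intro mult_le_mono2) simp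
    then show ?thesis unfolding e add_mult_distrib2 using assms(3) by simp
  qed (use assms(2) in simp)
  then have "Suc ((n + 1) * (length (drop l y) + length v) + length d') * (2 * L + 3)
    \<le> ((n + 1) * (length y + length v) + length d) * (2 * L + 3)"
    by (intro mult_le_mono1) simp
  then have "budget d' (length (drop l y) + length v) + (2 * L + 3) \<le> budget d (length y + length v)"
    unfolding budget_def by simp
  moreover have "reads x' eu (drop l y) ev \<le> 2 * L + 3"
  proof -
    have "of_bool (\<not> eu) \<le> (1::nat)" "of_bool (\<not> ev) \<le> (1::nat)" by simp_all
    then show ?thesis unfolding reads_def by linarith
  qed
  moreover have "0 < reads x eu y ev" unfolding reads_def by simp
  ultimately show ?thesis unfolding weight_def by linarith
qed

lemma aut_correct:
  assumes "pc c" "pc d" "pc p" "length x \<le> L" "length y \<le> L" "eu \<longrightarrow> u = []" "ev \<longrightarrow> v = []"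
  shows "\<exists>k \<le> weight d x eu y ev v.
    halts aut verdict_of k (Work c d p x eu y ev) u v (eqv_poss p (c @ x @ u) (d @ y @ v))"
  using assms
proof (induction "weight d x eu y ev v" arbitrary: c d p x eu y ev u v rule: less_induct)
  case less
  have one: "\<exists>k \<le> weight d x eu y ev v. halts aut verdict_of k (Work c d p x eu y ev) u v b"
    if "aut (Work c d p x eu y ev) (next_letter u) (next_letter v) = (q, m, m')"
      "halts aut verdict_of k q (if m then tl u else u) (if m' then tl v else v) b"
      "k < weight d x eu y ev v" for q m m' k b
    using halts.move[of verdict_of "Work c d p x eu y ev" aut u v q m m' k b] that
    by (intro exI[of _ "Suc k"]) auto
  show ?case
  proof (cases "length x < L \<and> \<not> eu")
    case True
    show ?thesis
    proof (cases u)
      case Nil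
      have w: "weight d x True y ev v < weight d x eu y ev v" using True by (simp add: weight_def reads_def)
      from less.hyps[OF w less.prems(1-5)] Nil less.prems(7) obtain k where
        "k \<le> weight d x True y ev v" "halts aut verdict_of k (Work c d p x True y ev) u v (eqv_poss p (c @ x @ u) (d @ y @ v))"
        by auto
      then show ?thesis using w
        by (intro one[where k = k]) (use True Nil in \<open>auto simp: next_letter_def\<close>)
    next
      case (Cons a u')
      have "L - length (x @ [a]) < L - length x"
        using True by (intro diff_less_mono2) auto
      then have w: "weight d (x @ [a]) eu y ev v < weight d x eu y ev v"
        unfolding weight_def reads_def by linarith
      from less.hyps[OF w less.prems(1-3), of u'] True less.prems(5,7) obtain k where
        "k \<le> weight d (x @ [a]) eu y ev v"
        "halts aut verdict_of k (Work c d p (x @ [a]) eu y ev) u' v (eqv_poss p (c @ (x @ [a]) @ u') (d @ y @ v))"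
        by auto
      then show ?thesis using w
        by (intro one[where k = k]) (use True Cons in \<open>auto simp: next_letter_def\<close>)
    qed
  next
    case F1: False
    show ?thesis
    proof (cases "length y < L \<and> \<not> ev")
      case True
      show ?thesis
      proof (cases v)
        case Nil
        have w: "weight d x eu y True v < weight d x eu y ev v" using True by (simp add: weight_def reads_def)
        from less.hyps[OF w less.prems(1-5)] Nil less.prems(6) obtain k where
          "k \<le> weight d x eu y True v" "halts aut verdict_of k (Work c d p x eu y True) u v (eqv_poss p (c @ x @ u) (d @ y @ v))"
          by auto
        then show ?thesis using w
          by (intro one[where k = k]) (use F1 True Nil in \<open>auto simp: next_letter_def\<close>)
      next
        case (Cons a v')
        have "L - length (y @ [a]) < L - length y"
          using True by (intro diff_less_mono2) auto
        moreover have "budget d (length (y @ [a]) + length v') = budget d (length y + length v)"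
          using Cons by simp
        ultimately have w: "weight d x eu (y @ [a]) ev v' < weight d x eu y ev v"
          unfolding weight_def reads_def by linarith
        from less.hyps[OF w less.prems(1-4), of u] True less.prems(6) obtain k where
          "k \<le> weight d x eu (y @ [a]) ev v'"
          "halts aut verdict_of k (Work c d p x eu (y @ [a]) ev) u v' (eqv_poss p (c @ x @ u) (d @ (y @ [a]) @ v'))"
          by auto
        then show ?thesis using w
          by (intro one[where k = k]) (use F1 True Cons in \<open>auto simp: next_letter_def\<close>)
      qed
    next
      case F2: False
      have e: "ext x u" "ext y v" using F1 F2 less.prems unfolding ext_def by auto
      note cG = correct_next_verdict[OF less.prems(1-3), of x y]
      show ?thesis
      proof (cases "next_verdict c d p x y")
        case (Ans b)
        then have "b = eqv_poss p (c @ x @ u) (d @ y @ v)" using cG e by simp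
        moreover have "halts aut verdict_of 0 (Done b) u v b" by (rule halts.halted) simp
        moreover have "0 < weight d x eu y ev v" by (simp add: weight_def reads_def)
        ultimately show ?thesis
          by (intro one[where k = 0]) (use F1 F2 Ans in auto)
      next
        case (Next c' k d' l p')
        then have N: "pc c'" "pc d'" "pc p'" "l \<le> length y" "0 < l \<or> length d' < length d"
          "eqv_poss p (c @ x @ u) (d @ y @ v) = eqv_poss p' (c' @ drop k x @ u) (d' @ drop l y @ v)"
          using cG e by simp_all
        have w: "weight d' (drop k x) eu (drop l y) ev v < weight d x eu y ev v"
          using weight_Next[OF N(4,5) piece_bound[OF N(2)]] .
        have dl: "length (drop k x) \<le> L" "length (drop l y) \<le> L" using less.prems(4,5) by auto
        from less.hyps[OF w N(1-3) dl less.prems(6,7)] obtain j where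
          "j \<le> weight d' (drop k x) eu (drop l y) ev v"
          "halts aut verdict_of j (Work c' d' p' (drop k x) eu (drop l y) ev) u v (eqv_poss p (c @ x @ u) (d @ y @ v))"
          unfolding N(6) by blast
        then show ?thesis using w
          by (intro one[where k = j]) (use F1 F2 Next in auto)
      qed
    qed
  qed
qed

lemma aut_decides:
  assumes A: "finite A" "R \<subseteq> lists A \<times> lists A"
  shows "\<exists>Q c d. decides A Q aut verdict_of (Work [] [] [] [] False [] False) c d eqv"
proof -
  let ?P = "{c. pc c}" and ?B = "{w. set w \<subseteq> A \<and> length w \<le> L}"
  let ?Q = "(\<lambda>(c, d, p, x, eu, y, ev). Work c d p x eu y ev) ` (?P \<times> ?P \<times> ?P \<times> ?B \<times> UNIV \<times> ?B \<times> UNIV)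
    \<union> range Done"
  have "set p \<subseteq> A" if "pc p" for p
  proof -
    have "p = [] \<or> (\<exists>w\<in>W. sublist p w)"
      using that unfolding piece_def factor_of_side_def relation_words_def occurs_twice_def
      by (auto simp: sublist_def)
    moreover have "set w \<subseteq> A" if "w \<in> W" for w
      using that A(2) unfolding relation_words_def by fastforce
    ultimately show ?thesis by (metis empty_set empty_subsetI set_mono_sublist subset_trans)
  qed
  then have "?P \<subseteq> {w. set w \<subseteq> A \<and> length w \<le> n}" using piece_bound by auto
  then have fP: "finite ?P" using finite_lists_length_le[OF A(1)] finite_subset by blast
  have fB: "finite ?B" using finite_lists_length_le[OF A(1)] by blast
  have mem: "Work c d p x eu y ev \<in> ?Q \<longleftrightarrow> pc c \<and> pc d \<and> pc p \<and> x \<in> ?B \<and> y \<in> ?B" for c d p x eu y ev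
    by (auto simp: image_iff)
  have f1: "finite ?Q" using fP fB by (intro finite_UnI finite_imageI finite_SigmaI) auto
  have f2: "Work [] [] [] [] False [] False \<in> ?Q" unfolding mem by simp
  have f3: "fst (aut q o1 o2) \<in> ?Q"
    if q: "q \<in> ?Q" and o: "o1 \<in> insert None (Some ` A)" "o2 \<in> insert None (Some ` A)" for q o1 o2
  proof (cases q)
    case (Done b)
    then show ?thesis by simp
  next
    case (Work c d p x eu y ev)
    have w: "pc c" "pc d" "pc p" "set x \<subseteq> A" "length x \<le> L" "set y \<subseteq> A" "length y \<le> L"
      using q unfolding Work mem by auto
    consider "length x < L \<and> \<not> eu" | "\<not> (length x < L \<and> \<not> eu)" "length y < L \<and> \<not> ev"
      | "\<not> (length x < L \<and> \<not> eu)" "\<not> (length y < L \<and> \<not> ev)" by blast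
    then show ?thesis
    proof cases
      case 1
      then have "fst (aut q o1 o2) = (case o1 of None \<Rightarrow> Work c d p x True y ev | Some a \<Rightarrow> Work c d p (x @ [a]) eu y ev)"
        unfolding Work by (simp split: option.split)
      then show ?thesis using o w 1 by (cases o1) (auto simp only: option.simps mem, auto)
    next
      case 2
      then have "fst (aut q o1 o2) = (case o2 of None \<Rightarrow> Work c d p x eu y True | Some a \<Rightarrow> Work c d p x eu (y @ [a]) ev)"
        unfolding Work by (simp split: option.split)
      then show ?thesis using o w 2 by (cases o2) (auto simp only: option.simps mem, auto)
    next
      case 3
      note cG = correct_next_verdict[OF w(1-3), of x y]
      have s: "set (drop k x) \<subseteq> A" "set (drop k y) \<subseteq> A" for k
        using w set_drop_subset by (metis subset_trans)+
      show ?thesis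
      proof (cases "next_verdict c d p x y")
        case (Ans b)
        then show ?thesis using 3 unfolding Work by auto
      next
        case (Next c' k d' l p')
        then have "fst (aut q o1 o2) = Work c' d' p' (drop k x) eu (drop l y) ev"
          using 3 unfolding Work by auto
        moreover have "pc c'" "pc d'" "pc p'" using cG Next by simp_all
        ultimately show ?thesis using w s by (simp only: mem) auto
      qed
    qed
  qed
  have f4: "\<exists>k \<le> ((n + 1) * (2 * L + 3)) * length v + (2 * L + 3).
      halts aut verdict_of k (Work [] [] [] [] False [] False) u v (eqv u v)" for u v
  proof -
    have "weight [] [] False [] False v = ((n + 1) * (2 * L + 3)) * length v + (2 * L + 3)"
      unfolding weight_def budget_def reads_def by (simp add: algebra_simps)
    then show ?thesis using aut_correct[of "[]" "[]" "[]" "[]" "[]" False u False v] by (simp add: eqv_poss_Nil)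
  qed
  have "decides A ?Q aut verdict_of (Work [] [] [] [] False [] False)
      ((n + 1) * (2 * L + 3)) (2 * L + 3) eqv"
    unfolding decides_def by (intro conjI ballI f1 f2 f3 f4)
  then show ?thesis by blast
qed

lemma presentation_cong_iff_eqv:
  assumes R: "R \<subseteq> lists A \<times> lists A" and u: "u \<in> lists A"
  shows "(u, v) \<in> presentation_cong A R \<longleftrightarrow> eqv u v"
proof
  show "eqv u v" if "(u, v) \<in> presentation_cong A R"
    using that
  proof induction
    case (rel x y)
    then have "ptn x y" by (simp add: partner_def)
    then show ?case using eqv_rel[of x y "[]"] by simp
  next
    case (mult x x' y y')
    then have "eqv (x @ y) (x' @ y)" "eqv (x' @ y) (x' @ y')" using eqv_ctx[of _ _ "[]"] eqv_left by auto
    then show ?case by (rule eqv_trans)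
  qed (use eqv_sym eqv_trans in blast)+
next
  have rw: "w' \<in> lists A \<and> (w, w') \<in> presentation_cong A R" if w: "w \<in> lists A" and s: "rw w w'" for w w'
  proof -
    obtain a b r r' where *: "ptn r r'" "w = a @ r @ b" "w' = a @ r' @ b"
      using s unfolding rw_def by blast
    then have "(r, r') \<in> presentation_cong A R" "r' \<in> lists A"
      using R unfolding partner_def by (auto intro: presentation_cong.rel presentation_cong.sym)
    then show ?thesis using * w
      by (auto intro!: presentation_cong.mult intro: presentation_cong.refl)
  qed
  have "v \<in> lists A \<and> (u, v) \<in> presentation_cong A R" if "eqv u v"
    using that
  proof induction
    case base
    then show ?case using u by (simp add: presentation_cong.refl)
  next
    case (step y z)
    then show ?case using rw presentation_cong.trans by blast
  qed
  then show "eqv u v \<Longrightarrow> (u, v) \<in> presentation_cong A R" by blast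
qed

end

theorem automaton_decides_word_problem:
  fixes A :: "'a set"
  assumes "finite_presentation A R" "small_overlap 4 R"
  shows "\<exists>Q (\<delta> :: ('a control, 'a) automaton) q0 c d.
    decides A Q \<delta> verdict_of q0 c d (\<lambda>u v. (u, v) \<in> presentation_cong A R)"
proof -
  have A: "finite A" "R \<subseteq> lists A \<times> lists A" "finite (relation_words R)"
    using assms(1) unfolding finite_presentation_def relation_words_def by auto
  \<comment> \<open>Without relations this is the maximum of the empty set, but then the length
    bound holds vacuously.\<close>
  interpret C4_bounded R "Max (length ` relation_words R)"
    by unfold_locales (use assms(2) A(3) in auto)
  obtain Q c d where "decides A Q aut verdict_of (Work [] [] [] [] False [] False) c d eqv"
    using aut_decides[OF A(1,2)] by blast
  then have "decides A Q aut verdict_of (Work [] [] [] [] False [] False) c d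
      (\<lambda>u v. (u, v) \<in> presentation_cong A R)"
    by (subst decides_cong[OF presentation_cong_iff_eqv[OF A(2)]])
  then show ?thesis by blast
qed

section \<open>Reversal\<close>

definition reversed :: "('a list \<times> 'a list) set \<Rightarrow> ('a list \<times> 'a list) set" where
  "reversed R = map_prod rev rev ` R"

lemma reversed_reversed [simp]: "reversed (reversed R) = R"
  by (simp add: reversed_def image_image map_prod.compositionality o_def map_prod.identity[unfolded id_def])

lemma finite_presentation_reversed:
  "finite_presentation A R \<Longrightarrow> finite_presentation A (reversed R)"
  unfolding finite_presentation_def reversed_def by auto

lemma relation_words_reversed: "relation_words (reversed R) = rev ` relation_words R"
  by (auto simp: relation_words_def reversed_def image_Un image_image)

lemma factor_of_side_rev: "factor_of_side p (map_prod rev rev r) \<longleftrightarrow> factor_of_side (rev p) r"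
  unfolding factor_of_side_def by (cases r) (auto simp: sublist_rev_left)

lemma occurs_twice_rev:
  assumes "occurs_twice p (rev w)"
  shows "occurs_twice (rev p) w"
proof -
  obtain x y x' y' where *: "rev w = x @ p @ y" "rev w = x' @ p @ y'" "x \<noteq> x'"
    using assms unfolding occurs_twice_def by blast
  then have "w = rev y @ rev p @ rev x" "w = rev y' @ rev p @ rev x'"
    by (metis rev_append rev_rev_ident append.assoc)+
  \<comment> \<open>After reversal the suffixes play the role of the distinguishing prefixes; equal
    suffixes would force equal prefixes.\<close>
  moreover have "rev y \<noteq> rev y'" using * by auto
  ultimately show ?thesis unfolding occurs_twice_def by blast
qed

lemma piece_reversed:
  assumes "piece (reversed R) p"
  shows "piece R (rev p)"
proof -
  from assms consider "p = []"
    | r r' where "r \<in> R" "r' \<in> R" "r \<noteq> r'" "factor_of_side p (map_prod rev rev r)" "factor_of_side p (map_prod rev rev r')"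
    | r where "r \<in> R" "sublist p (rev (fst r))" "sublist p (rev (snd r))"
    | w where "w \<in> relation_words R" "occurs_twice p (rev w)"
    unfolding piece_def relation_words_reversed unfolding reversed_def by (auto; force)
  then show ?thesis
  proof cases
    case 2
    then show ?thesis unfolding piece_def factor_of_side_rev by blast
  next
    case 3
    then show ?thesis unfolding piece_def sublist_rev_left[symmetric] by auto
  next
    case 4
    then show ?thesis unfolding piece_def using occurs_twice_rev by blast
  qed simp
qed

lemma small_overlap_reversed:
  assumes "small_overlap n R"
  shows "small_overlap n (reversed R)"
  unfolding small_overlap_def
proof (intro ballI notI)
  fix w assume "w \<in> relation_words (reversed R)"
  then have w: "rev w \<in> relation_words R" by (auto simp: relation_words_reversed)
  assume "\<exists>ps. length ps < n \<and> (\<forall>p\<in>set ps. piece (reversed R) p) \<and> w = concat ps"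
  then obtain ps where ps: "length ps < n" "\<forall>p\<in>set ps. piece (reversed R) p" "w = concat ps" by blast
  then have "rev w = concat (map rev (rev ps))" by (simp add: rev_concat rev_map)
  moreover have "\<forall>p\<in>set (map rev (rev ps)). piece R p" using ps piece_reversed by auto
  ultimately show False using assms w ps(1) unfolding small_overlap_def
    by (metis length_map length_rev)
qed

lemma presentation_cong_reversed:
  "(rev u, rev v) \<in> presentation_cong A (reversed R) \<longleftrightarrow> (u, v) \<in> presentation_cong A R"
proof -
  have *: "(rev u, rev v) \<in> presentation_cong A (reversed R)"
    if "(u, v) \<in> presentation_cong A R" for R and u v :: "'a list"
    using that
  proof induction
    case (rel x y)
    then show ?case by (intro presentation_cong.rel) (force simp: reversed_def)
  qed (auto intro: presentation_cong.intros)
  show ?thesis using *[of u v R] *[of "rev u" "rev v" "reversed R"] by auto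
qed


section \<open>The Turing machine\<close>

text \<open>Most machine steps write back the scanned symbol; this reduces the equality of the old
  and new tape to the content of one cell.\<close>

declare fun_upd_idem_iff [simp]

definition reaches :: "('q, 's) two_tape_tm \<Rightarrow> nat \<Rightarrow> ('q, 's) config \<Rightarrow> ('q, 's) config \<Rightarrow> bool" where
  "reaches M n C C' \<longleftrightarrow> (\<exists>t\<le>n. (step M ^^ t) C = C')"

lemma reaches_refl [simp]: "reaches M n C C"
  unfolding reaches_def by (intro exI[of _ 0]) simp

lemma reaches_trans:
  assumes "reaches M m C C'" "reaches M n C' C''"
  shows "reaches M (m + n) C C''"
proof -
  obtain s t where "s \<le> m" "t \<le> n" "(step M ^^ s) C = C'" "(step M ^^ t) C' = C''"
    using assms unfolding reaches_def by blast
  then show ?thesis unfolding reaches_def by (intro exI[of _ "t + s"]) (simp add: funpow_add)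
qed

lemma reaches_step:
  assumes "step M C = C'" "reaches M n C' C''"
  shows "reaches M (Suc n) C C''"
proof -
  have "reaches M 1 C C'" unfolding reaches_def by (intro exI[of _ 1]) (simp add: assms(1))
  then show ?thesis using reaches_trans[OF _ assms(2)] by fastforce
qed

lemma reaches_one: "step M C = C' \<Longrightarrow> reaches M (Suc 0) C C'"
  using reaches_step reaches_refl by metis

lemma reaches_mono: "reaches M m C C' \<Longrightarrow> m \<le> n \<Longrightarrow> reaches M n C C'"
  unfolding reaches_def using le_trans by blast

fun symbol_letter :: "'a tape_symbol \<Rightarrow> 'a option" where
  "symbol_letter (Gen a) = Some a"
| "symbol_letter _ = None"

definition dir :: "bool \<Rightarrow> move" where
  "dir b = (if b then MoveRight else MoveLeft)"

definition sg :: "bool \<Rightarrow> int" where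
  "sg b = (if b then 1 else -1)"

lemma offset_dir [simp]: "offset (dir b) = sg b" "sg (\<not> b) = - sg b"
  by (auto simp: dir_def sg_def)

fun ahead :: "(int \<Rightarrow> 'a tape_symbol) \<Rightarrow> int \<Rightarrow> int \<Rightarrow> 'a list \<Rightarrow> bool" where
  "ahead f h s [] \<longleftrightarrow> f h = Sep"
| "ahead f h s (a # w) \<longleftrightarrow> f h = Gen a \<and> ahead f (h + s) s w"

lemma ahead_nth: "ahead f h s w \<Longrightarrow> k < length w \<Longrightarrow> f (h + s * int k) = Gen (w ! k)"
proof (induction w arbitrary: h k)
  case (Cons a w)
  then show ?case using Cons.IH[of "h + s" "k - 1"] by (cases k) (simp_all add: algebra_simps)
qed simp

lemma ahead_end: "ahead f h s w \<Longrightarrow> f (h + s * int (length w)) = Sep"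
proof (induction w arbitrary: h)
  case (Cons a w)
  then show ?case using Cons.IH[of "h + s"] by (simp add: algebra_simps)
qed simp

lemma aheadI:
  "(\<And>k. k < length w \<Longrightarrow> f (h + s * int k) = Gen (w ! k)) \<Longrightarrow> f (h + s * int (length w)) = Sep
    \<Longrightarrow> ahead f h s w"
proof (induction w arbitrary: h)
  case (Cons a w)
  have "ahead f (h + s) s w"
  proof (rule Cons.IH)
    show "f (h + s + s * int k) = Gen (w ! k)" if "k < length w" for k
      using Cons.prems(1)[of "Suc k"] that by (simp add: algebra_simps)
  qed (use Cons.prems(2) in \<open>simp add: algebra_simps\<close>)
  then show ?case using Cons.prems(1)[of 0] by simp
qed simp

text \<open>\<open>ZL\<close>, \<open>ZB\<close>, \<open>ZR\<close> and \<open>ZC\<close> find the shorter word up to a factor of two: the head of the first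
  tape makes excursions from the middle separator to the left and to the right whose lengths are
  measured by a ruler of symbols \<open>Aux 0\<close> on the second tape. The way back from the left doubles
  the ruler. Then \<open>CP b\<close> copies the shorter word to the second tape, from its outer end to the
  middle, \<open>BK b\<close> returns to the start of the copy, and \<open>RUN b\<close> simulates an automaton that reads
  both words to the right if \<open>b\<close> holds and to the left otherwise.\<close>

datatype 'q tm_state = S0 | ZL | ZB | ZR | ZC | CP bool | BK bool | RUN bool 'q | FIN bool

definition bounded_ruler :: "(int \<Rightarrow> 'a tape_symbol) \<Rightarrow> int \<Rightarrow> bool" where
  "bounded_ruler g K \<longleftrightarrow> g 0 = Sep \<and> (\<forall>i. 1 \<le> i \<and> i \<le> K \<longrightarrow> g i = Aux 0) \<and> (\<forall>i>K. g i = Blank)"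

text \<open>The second argument of \<open>P b\<close> is the word copied to the second tape, since
  the running time of the automaton is linear in its second word: this is \<open>u\<close> for
  \<open>True\<close> and the reversal of \<open>v\<close> for \<open>False\<close>.\<close>

locale word_machine =
  fixes A :: "'a set" and Q :: "bool \<Rightarrow> 'q set" and \<delta> :: "bool \<Rightarrow> ('q, 'a) automaton"
    and out :: "'q \<Rightarrow> bool option" and q0 :: "bool \<Rightarrow> 'q" and c d :: "bool \<Rightarrow> nat"
    and P :: "bool \<Rightarrow> 'a list \<Rightarrow> 'a list \<Rightarrow> bool" and E :: "'a list \<Rightarrow> 'a list \<Rightarrow> bool"
  assumes dec: "decides A (Q b) (\<delta> b) out (q0 b) (c b) (d b) (P b)"
    and finA: "finite A"
    and P_True: "u \<in> lists A \<Longrightarrow> v \<in> lists A \<Longrightarrow> P True v u \<longleftrightarrow> E u v"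
    and P_False: "u \<in> lists A \<Longrightarrow> v \<in> lists A \<Longrightarrow> P False (rev u) (rev v) \<longleftrightarrow> E u v"
begin

text \<open>The separator written on entering \<open>CP\<close> lies just behind the first cell of
  the copy and is the mark at which \<open>BK\<close> stops. In \<open>RUN\<close>, a head never
  leaves the separator ending its word, in accordance with \<open>tl [] = []\<close> in
  \<open>halts\<close>.\<close>

fun tm_delta :: "'q tm_state \<Rightarrow> 'a tape_symbol \<Rightarrow> 'a tape_symbol
    \<Rightarrow> 'q tm_state \<times> ('a tape_symbol \<times> move) \<times> ('a tape_symbol \<times> move)" where
  "tm_delta S0 a b = (ZL, (a, MoveLeft), (Sep, MoveRight))"
| "tm_delta ZL a b =
    (if a = Sep then (CP True, (a, MoveRight), (Sep, MoveRight))
     else if b = Blank then (ZB, (a, MoveRight), (Aux 0, MoveRight))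
     else (ZL, (a, MoveLeft), (b, MoveRight)))"
| "tm_delta ZB a b =
    (if a = Sep then (ZR, (a, MoveRight), (b, MoveLeft))
     else (ZB, (a, MoveRight), (Aux 0, MoveRight)))"
| "tm_delta ZR a b =
    (if a = Sep then (CP False, (a, MoveLeft), (Sep, MoveLeft))
     else if b = Sep then (ZC, (a, MoveLeft), (b, Stay))
     else (ZR, (a, MoveRight), (b, MoveLeft)))"
| "tm_delta ZC a b =
    (if a = Sep then (ZL, (a, MoveLeft), (b, MoveRight))
     else (ZC, (a, MoveLeft), (b, Stay)))"
| "tm_delta (CP r) a b =
    (if a = Sep then (BK r, (a, Stay), (Sep, dir (\<not> r)))
     else (CP r, (a, dir r), (a, dir r)))"
| "tm_delta (BK r) a b =
    (if b = Sep then (RUN r (q0 r), (a, dir r), (b, dir r))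
     else (BK r, (a, Stay), (b, dir (\<not> r))))"
| "tm_delta (RUN r q) a b =
    (case out q of
       Some z \<Rightarrow> (FIN z, (a, Stay), (b, Stay))
     | None \<Rightarrow> (case \<delta> r q (symbol_letter a) (symbol_letter b) of
         (q', m, m') \<Rightarrow> (RUN r q', (a, if m \<and> symbol_letter a \<noteq> None then dir r else Stay),
           (b, if m' \<and> symbol_letter b \<noteq> None then dir r else Stay))))"
| "tm_delta (FIN z) a b = (FIN z, (a, Stay), (b, Stay))"

definition TM :: "('q tm_state, 'a tape_symbol) two_tape_tm" where
  "TM = \<lparr>states = {S0, ZL, ZB, ZR, ZC} \<union> range CP \<union> range BK \<union> (\<Union>b. RUN b ` Q b) \<union> range FIN,
     tape_alphabet = {Blank, Sep, Aux 0} \<union> Gen ` A,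
     start = S0, accept = FIN True, reject = FIN False, delta = tm_delta\<rparr>"

lemma TM_simps [simp]:
  "start TM = S0" "accept TM = FIN True" "reject TM = FIN False" "delta TM = tm_delta"
  "tape_alphabet TM = {Blank, Sep, Aux 0} \<union> Gen ` A"
  by (simp_all add: TM_def)

lemma is_tm: "is_two_tape_tm TM"
proof -
  have D: "finite (Q b)" "q0 b \<in> Q b"
    "\<lbrakk>q \<in> Q b; o1 \<in> insert None (Some ` A); o2 \<in> insert None (Some ` A)\<rbrakk> \<Longrightarrow> fst (\<delta> b q o1 o2) \<in> Q b"
    for b q o1 o2
    using dec[of b] unfolding decides_def by blast+
  have mem: "S0 \<in> states TM" "ZL \<in> states TM" "ZB \<in> states TM" "ZR \<in> states TM" "ZC \<in> states TM"
    "CP b \<in> states TM" "BK b \<in> states TM" "FIN b \<in> states TM" "RUN b q \<in> states TM \<longleftrightarrow> q \<in> Q b" for b q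
    by (auto simp: TM_def)
  have "tm_delta q a b \<in> states TM \<times> (tape_alphabet TM \<times> UNIV) \<times> (tape_alphabet TM \<times> UNIV)"
    if q: "q \<in> states TM" and a: "a \<in> tape_alphabet TM" and b: "b \<in> tape_alphabet TM" for q a b
  proof (cases q)
    case (RUN r q1)
    then have "q1 \<in> Q r" using q mem by simp
    moreover have "symbol_letter a \<in> insert None (Some ` A)" "symbol_letter b \<in> insert None (Some ` A)"
      using a b by auto
    ultimately have "fst (\<delta> r q1 (symbol_letter a) (symbol_letter b)) \<in> Q r" by (rule D(3))
    then show ?thesis using RUN a b mem by (auto split: option.split prod.split)
  qed (use a b D(2) mem in auto)
  moreover have "finite (states TM)" using D(1) by (simp add: TM_def)
  ultimately show ?thesis unfolding is_two_tape_tm_def using finA mem by simp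
qed

section \<open>Copying the shorter word and simulating the automaton\<close>

lemma run_phase:
  assumes "halts (\<delta> r) out k q u v z" "ahead f h (sg r) u" "ahead g j (sg r) v"
  shows "\<exists>h' j'. reaches TM (Suc k) (RUN r q, (f, h), (g, j)) (FIN z, (f, h'), (g, j'))"
  using assms
proof (induction arbitrary: h j rule: halts.induct)
  case (halted q b u v)
  have "step TM (RUN r q, (f, h), (g, j)) = (FIN b, (f, h), (g, j))"
    using halted by simp
  then show ?case using reaches_one by blast
next
  case (move q u v q' m m' k b)
  have l: "symbol_letter (f h) = next_letter u" if "ahead f h (sg r) u" for f h u
    using that by (cases u) (auto simp: next_letter_def)
  define h1 where "h1 = (if m \<and> u \<noteq> [] then h + sg r else h)"
  define j1 where "j1 = (if m' \<and> v \<noteq> [] then j + sg r else j)"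
  have "step TM (RUN r q, (f, h), (g, j)) = (RUN r q', (f, h1), (g, j1))"
    using move(1,2) l[OF move(5)] l[OF move(6)]
    by (auto simp: h1_def j1_def next_letter_def split: list.splits)
  moreover have "ahead f h1 (sg r) (if m then tl u else u)"
    using move(5) by (cases u) (auto simp: h1_def)
  moreover have "ahead g j1 (sg r) (if m' then tl v else v)"
    using move(6) by (cases v) (auto simp: j1_def)
  ultimately show ?case using move.IH reaches_step by blast
qed

text \<open>The last clause preserves the separator behind the start of the copy; remains of the
  ruler in the way of the copy are overwritten.\<close>

lemma copy_phase:
  assumes "ahead f h (sg r) w"
  shows "\<exists>g'. reaches TM (Suc (length w)) (CP r, (f, h), (g, j))
      (BK r, (f, h + sg r * int (length w)), (g', j + sg r * int (length w) - sg r)) \<and>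
    ahead g' j (sg r) w \<and> (\<forall>x. (\<forall>i::nat. x \<noteq> j + sg r * int i) \<longrightarrow> g' x = g x)"
  using assms
proof (induction w arbitrary: h g j)
  case Nil
  have "step TM (CP r, (f, h), (g, j)) = (BK r, (f, h), (g(j := Sep), j - sg r))"
    using Nil by simp
  then have "reaches TM (Suc 0) (CP r, (f, h), (g, j)) (BK r, (f, h), (g(j := Sep), j - sg r))"
    by (rule reaches_one)
  moreover have "(g(j := Sep)) x = g x" if "\<forall>i::nat. x \<noteq> j + sg r * int i" for x
    using that[rule_format, of 0] by simp
  ultimately show ?case by (intro exI[of _ "g(j := Sep)"]) (simp del: fun_upd_apply, simp)
next
  case (Cons a w)
  have s: "step TM (CP r, (f, h), (g, j)) = (CP r, (f, h + sg r), (g(j := Gen a), j + sg r))"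
    using Cons.prems by simp
  have "ahead f (h + sg r) (sg r) w" using Cons.prems by simp
  from Cons.IH[OF this, of "g(j := Gen a)" "j + sg r"] obtain g' where g':
    "reaches TM (Suc (length w)) (CP r, (f, h + sg r), (g(j := Gen a), j + sg r))
      (BK r, (f, h + sg r + sg r * int (length w)), (g', j + sg r + sg r * int (length w) - sg r))"
    "ahead g' (j + sg r) (sg r) w"
    "\<And>x. (\<forall>i::nat. x \<noteq> j + sg r + sg r * int i) \<Longrightarrow> g' x = (g(j := Gen a)) x"
    by blast
  have "j \<noteq> j + sg r + sg r * int i" for i by (auto simp: sg_def)
  then have "g' j = Gen a" using g'(3)[of j] by simp
  moreover have "g' x = g x" if x: "\<forall>i::nat. x \<noteq> j + sg r * int i" for x
  proof -
    have "x \<noteq> j + sg r + sg r * int i" for i using x[rule_format, of "Suc i"] by (simp add: algebra_simps)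
    moreover have "x \<noteq> j" using x[rule_format, of 0] by simp
    ultimately show ?thesis using g'(3)[of x] by simp
  qed
  moreover have "reaches TM (Suc (length (a # w))) (CP r, (f, h), (g, j))
      (BK r, (f, h + sg r * int (length (a # w))), (g', j + sg r * int (length (a # w)) - sg r))"
    using reaches_step[OF s g'(1)] by (simp add: algebra_simps)
  ultimately show ?case using g'(2) by auto
qed

lemma back_phase:
  assumes "ahead g j (sg r) w" "g (j - sg r) = Sep" "k \<le> length w"
  shows "reaches TM (Suc k) (BK r, (f, h), (g, j + sg r * int k - sg r)) (RUN r (q0 r), (f, h + sg r), (g, j))"
  using assms(3)
proof (induction k)
  case 0
  have "step TM (BK r, (f, h), (g, j + sg r * int 0 - sg r)) = (RUN r (q0 r), (f, h + sg r), (g, j))"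
    using assms(2) by simp
  then show ?case by (rule reaches_one)
next
  case (Suc k)
  have e: "j + sg r * int (Suc k) - sg r = j + sg r * int k" by (simp add: algebra_simps)
  have "step TM (BK r, (f, h), (g, j + sg r * int (Suc k) - sg r)) = (BK r, (f, h), (g, j + sg r * int k - sg r))"
    unfolding e using ahead_nth[OF assms(1), of k] Suc.prems by simp
  then show ?case using reaches_step Suc by force
qed

lemma compare_phase:
  assumes w: "w \<in> lists A" "w' \<in> lists A" and "ahead f h (sg r) w" "g (j - sg r) = Sep"
    and "ahead f (h + sg r * int (length w) + sg r) (sg r) w'"
  shows "\<exists>t1 t2. reaches TM ((c r + 2) * length w + d r + 3) (CP r, (f, h), (g, j)) (FIN (P r w' w), t1, t2)"
proof -
  let ?h = "h + sg r * int (length w)"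
  obtain g' where g': "reaches TM (Suc (length w)) (CP r, (f, h), (g, j))
      (BK r, (f, ?h), (g', j + sg r * int (length w) - sg r))" "ahead g' j (sg r) w"
      "\<And>x. (\<forall>i::nat. x \<noteq> j + sg r * int i) \<Longrightarrow> g' x = g x"
    using copy_phase[OF assms(3)] by metis
  have "g' (j - sg r) = Sep"
    using g'(3)[of "j - sg r"] assms(4) by (auto simp: sg_def)
  then have b: "reaches TM (Suc (length w)) (BK r, (f, ?h), (g', j + sg r * int (length w) - sg r))
      (RUN r (q0 r), (f, ?h + sg r), (g', j))"
    using back_phase g'(2) by blast
  obtain k where k: "k \<le> c r * length w + d r" "halts (\<delta> r) out k (q0 r) w' w (P r w' w)"
    using dec[of r] w unfolding decides_def by blast
  then obtain h' j' where "reaches TM (Suc k) (RUN r (q0 r), (f, ?h + sg r), (g', j)) (FIN (P r w' w), (f, h'), (g', j'))"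
    using run_phase assms(5) g'(2) by blast
  \<comment> \<open>Copying and returning take \<open>length w + 1\<close> steps each, the
    simulation at most \<open>c r * length w + d r + 1\<close>.\<close>
  from reaches_trans[OF reaches_trans[OF g'(1) b] this]
  have "reaches TM ((c r + 2) * length w + d r + 3) (CP r, (f, h), (g, j)) (FIN (P r w' w), (f, h'), (g', j'))"
    by (rule reaches_mono) (use k(1) in \<open>simp add: algebra_simps\<close>)
  then show ?thesis by blast
qed

section \<open>Finding the shorter word by excursions of doubling length\<close>

context
  fixes f :: "int \<Rightarrow> 'a tape_symbol" and u v :: "'a list" and m :: int
  assumes u: "ahead f (m - 1) (-1) (rev u)" and v: "ahead f (m + 1) 1 v" and m: "f m = Sep"
begin

lemma left_letter: "0 < k \<Longrightarrow> k \<le> length u \<Longrightarrow> f (m - int k) \<noteq> Sep"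
  using ahead_nth[OF u, of "k - 1"] by (simp add: algebra_simps of_nat_diff)

lemma left_end: "f (m - int (Suc (length u))) = Sep"
  using ahead_end[OF u] by (simp add: algebra_simps)

lemma right_letter: "0 < k \<Longrightarrow> k \<le> length v \<Longrightarrow> f (m + int k) \<noteq> Sep"
  using ahead_nth[OF v, of "k - 1"] by (simp add: algebra_simps of_nat_diff)

lemma right_end: "f (m + int (Suc (length v))) = Sep"
  using ahead_end[OF v] by (simp add: algebra_simps)

lemma ZL_walk:
  assumes "bounded_ruler g (int K)" "k \<le> K" "k \<le> length u"
  shows "reaches TM k (ZL, (f, m - 1), (g, 1)) (ZL, (f, m - int (Suc k)), (g, int (Suc k)))"
  using assms(2,3)
proof (induction k)
  case (Suc k)
  have "g (int (Suc k)) = Aux 0" using assms(1) Suc.prems by (simp add: bounded_ruler_def)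
  then have "step TM (ZL, (f, m - int (Suc k)), (g, int (Suc k))) = (ZL, (f, m - int (Suc (Suc k))), (g, int (Suc (Suc k))))"
    using left_letter[of "Suc k"] Suc.prems by simp
  then have "reaches TM (Suc 0) (ZL, (f, m - int (Suc k)), (g, int (Suc k))) (ZL, (f, m - int (Suc (Suc k))), (g, int (Suc (Suc k))))"
    by (rule reaches_one)
  from reaches_trans[OF Suc.IH this] show ?case using Suc.prems by simp
qed simp

lemma ZB_walk:
  assumes "bounded_ruler g (int K)" "k \<le> length u"
  shows "\<exists>g'. reaches TM (Suc k) (ZB, (f, m - int k), (g, int (Suc K))) (ZR, (f, m + 1), (g', int (K + k))) \<and>
    bounded_ruler g' (int (K + k))"
  using assms
proof (induction k arbitrary: g K)
  case 0
  have "step TM (ZB, (f, m - int 0), (g, int (Suc K))) = (ZR, (f, m + 1), (g, int K))"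
    using m by simp
  then have "reaches TM (Suc 0) (ZB, (f, m - int 0), (g, int (Suc K))) (ZR, (f, m + 1), (g, int K))"
    by (rule reaches_one)
  then show ?case using 0 by auto
next
  case (Suc k)
  let ?g = "g(int (Suc K) := Aux 0)"
  have r: "bounded_ruler ?g (int (Suc K))" using Suc.prems by (auto simp: bounded_ruler_def)
  have s: "step TM (ZB, (f, m - int (Suc k)), (g, int (Suc K))) = (ZB, (f, m - int k), (?g, int (Suc (Suc K))))"
    using left_letter[of "Suc k"] Suc.prems by simp
  obtain g' where g': "reaches TM (Suc k) (ZB, (f, m - int k), (?g, int (Suc (Suc K)))) (ZR, (f, m + 1), (g', int (Suc K + k)))"
    "bounded_ruler g' (int (Suc K + k))" using Suc.IH[OF r] Suc.prems by (auto simp del: fun_upd_apply)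
  from reaches_step[OF s g'(1)] g'(2) show ?case by (intro exI[of _ g']) simp
qed

lemma ZR_walk:
  assumes "bounded_ruler g (int N)" "k \<le> N" "k \<le> length v"
  shows "reaches TM k (ZR, (f, m + 1), (g, int N)) (ZR, (f, m + int (Suc k)), (g, int (N - k)))"
  using assms(2,3)
proof (induction k)
  case (Suc k)
  have "g (int (N - k)) = Aux 0" using assms(1) Suc.prems by (simp add: bounded_ruler_def)
  then have "step TM (ZR, (f, m + int (Suc k)), (g, int (N - k))) = (ZR, (f, m + int (Suc (Suc k))), (g, int (N - k) - 1))"
    using right_letter[of "Suc k"] Suc.prems by simp
  moreover have "int (N - k) - 1 = int (N - Suc k)" using Suc.prems by simp
  ultimately have "step TM (ZR, (f, m + int (Suc k)), (g, int (N - k))) = (ZR, (f, m + int (Suc (Suc k))), (g, int (N - Suc k)))"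
    by (simp only:)
  then have "reaches TM (Suc 0) (ZR, (f, m + int (Suc k)), (g, int (N - k))) (ZR, (f, m + int (Suc (Suc k))), (g, int (N - Suc k)))"
    by (rule reaches_one)
  from reaches_trans[OF Suc.IH this] show ?case using Suc.prems by simp
qed simp

lemma ZC_walk:
  assumes "k \<le> length v"
  shows "reaches TM (Suc k) (ZC, (f, m + int k), (g, 0)) (ZL, (f, m - 1), (g, 1))"
  using assms
proof (induction k)
  case 0
  have "step TM (ZC, (f, m + int 0), (g, 0)) = (ZL, (f, m - 1), (g, 1))"
    using m by simp
  then show ?case using reaches_step reaches_refl by metis
next
  case (Suc k)
  have "step TM (ZC, (f, m + int (Suc k)), (g, 0)) = (ZC, (f, m + int k), (g, 0))"
    using right_letter[of "Suc k"] Suc.prems by simp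
  then show ?case using reaches_step Suc by force
qed

text \<open>The first head stands at the outer end of the word to be copied, so that copying ends at
  the middle separator.\<close>

definition found :: "('q tm_state, 'a tape_symbol) config \<Rightarrow> bool" where
  "found C \<longleftrightarrow>
    (\<exists>g j. length u \<le> 2 * min (length u) (length v) \<and> g (j - 1) = Sep \<and>
      C = (CP True, (f, m - int (length u)), (g, j))) \<or>
    (\<exists>g j. length v \<le> 2 * min (length u) (length v) \<and> g (j + 1) = Sep \<and>
      C = (CP False, (f, m + int (length v)), (g, j)))"

text \<open>If \<open>u\<close> ends within \<open>K\<close> letters, it is no longer than
  \<open>v\<close> by the second hypothesis. Otherwise \<open>K < length u\<close>, so a
  \<open>v\<close> of length at most \<open>2 * K + 1\<close> is shorter than
  \<open>2 * length u\<close>. If neither ends, the new ruler again satisfies the second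
  hypothesis.\<close>

lemma round:
  assumes g: "bounded_ruler g (int K)" and K: "K = 0 \<or> K < length v"
  shows "(\<exists>C. found C \<and> reaches TM (4 * Suc K) (ZL, (f, m - 1), (g, 1)) C) \<or>
    (\<exists>g'. bounded_ruler g' (int (2 * K + 1)) \<and> K < length u \<and> 2 * K + 1 < length v \<and>
      reaches TM (6 * Suc K) (ZL, (f, m - 1), (g, 1)) (ZL, (f, m - 1), (g', 1)))"
proof (cases "length u \<le> K")
  case True
  let ?j = "int (Suc (length u))"
  have "reaches TM (length u) (ZL, (f, m - 1), (g, 1)) (ZL, (f, m - ?j), (g, ?j))"
    using ZL_walk[OF g True] by simp
  moreover have "step TM (ZL, (f, m - ?j), (g, ?j)) = (CP True, (f, m - int (length u)), (g(?j := Sep), ?j + 1))"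
    using left_end by simp
  ultimately have "reaches TM (length u + Suc 0) (ZL, (f, m - 1), (g, 1)) (CP True, (f, m - int (length u)), (g(?j := Sep), ?j + 1))"
    by (rule reaches_trans[OF _ reaches_one])
  then have "reaches TM (4 * Suc K) (ZL, (f, m - 1), (g, 1)) (CP True, (f, m - int (length u)), (g(?j := Sep), ?j + 1))"
    by (rule reaches_mono) (use True in simp)
  moreover have "found (CP True, (f, m - int (length u)), (g(?j := Sep), ?j + 1))"
    unfolding found_def using True K by fastforce
  ultimately show ?thesis by blast
next
  case False
  \<comment> \<open>The ruler grows by one mark at the turning point and by \<open>K\<close> marks
    on the way back to the middle, which gives \<open>2 * K + 1\<close>.\<close>
  let ?g = "g(int (Suc K) := Aux 0)" and ?N = "2 * K + 1"
  have "reaches TM K (ZL, (f, m - 1), (g, 1)) (ZL, (f, m - int (Suc K)), (g, int (Suc K)))"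
    using ZL_walk[OF g, of K] False by simp
  moreover have "step TM (ZL, (f, m - int (Suc K)), (g, int (Suc K))) = (ZB, (f, m - int K), (?g, int (Suc (Suc K))))"
    using left_letter[of "Suc K"] False g by (simp add: bounded_ruler_def)
  ultimately have 1: "reaches TM (K + Suc 0) (ZL, (f, m - 1), (g, 1)) (ZB, (f, m - int K), (?g, int (Suc (Suc K))))"
    by (rule reaches_trans[OF _ reaches_one])
  have "bounded_ruler ?g (int (Suc K))" using g by (auto simp: bounded_ruler_def)
  then obtain g' where g': "reaches TM (Suc K) (ZB, (f, m - int K), (?g, int (Suc (Suc K)))) (ZR, (f, m + 1), (g', int (Suc K + K)))"
    "bounded_ruler g' (int (Suc K + K))" using ZB_walk[of ?g "Suc K" K] False by auto
  have N: "Suc K + K = ?N" by simp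
  have 2: "reaches TM (K + Suc 0 + Suc K) (ZL, (f, m - 1), (g, 1)) (ZR, (f, m + 1), (g', int ?N))"
    using reaches_trans[OF 1 g'(1)] unfolding N .
  have g'N: "bounded_ruler g' (int ?N)" using g'(2) unfolding N .
  show ?thesis
  proof (cases "length v \<le> ?N")
    case True
    let ?C = "(CP False, (f, m + int (length v)), (g'(int (?N - length v) := Sep), int (?N - length v) - 1))"
    have "reaches TM (length v) (ZR, (f, m + 1), (g', int ?N)) (ZR, (f, m + int (Suc (length v))), (g', int (?N - length v)))"
      using ZR_walk[OF g'N True] by simp
    moreover have "step TM (ZR, (f, m + int (Suc (length v))), (g', int (?N - length v))) = ?C"
      using right_end by simp
    ultimately have "reaches TM (length v + Suc 0) (ZR, (f, m + 1), (g', int ?N)) ?C"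
      by (rule reaches_trans[OF _ reaches_one])
    from reaches_trans[OF 2 this] have "reaches TM (4 * Suc K) (ZL, (f, m - 1), (g, 1)) ?C"
      by (rule reaches_mono) (use True in simp)
    moreover have "found ?C" unfolding found_def using True False by fastforce
    ultimately show ?thesis by blast
  next
    case F: False
    have "reaches TM ?N (ZR, (f, m + 1), (g', int ?N)) (ZR, (f, m + int (Suc ?N)), (g', int (?N - ?N)))"
      using ZR_walk[OF g'N, of ?N] F by simp
    moreover have "step TM (ZR, (f, m + int (Suc ?N)), (g', int (?N - ?N))) = (ZC, (f, m + int ?N), (g', 0))"
      using right_letter[of "Suc ?N"] F g'N by (simp add: bounded_ruler_def)
    ultimately have "reaches TM (?N + Suc 0) (ZR, (f, m + 1), (g', int ?N)) (ZC, (f, m + int ?N), (g', 0))"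
      by (rule reaches_trans[OF _ reaches_one])
    from reaches_trans[OF reaches_trans[OF 2 this] ZC_walk[of ?N]] F
    have "reaches TM (6 * Suc K) (ZL, (f, m - 1), (g, 1)) (ZL, (f, m - 1), (g', 1))"
      by (auto elim!: reaches_mono)
    then show ?thesis using g'N False F by auto
  qed
qed

text \<open>As \<open>Suc K\<close> doubles in each round, \<open>6 * Suc K\<close> bounds the cost
  of all earlier rounds, starting from \<open>K = 0\<close>. With the last round of
  \<open>4 * Suc K\<close> steps the total is at most \<open>10 * Suc K\<close>, and
  \<open>K\<close> is at most twice the minimum; hence \<open>20\<close> and
  \<open>10\<close>.\<close>

lemma zigzag_phase:
  assumes "bounded_ruler g (int K)" "K = 0 \<or> K < length v" "K \<le> 2 * min (length u) (length v)"
  shows "\<exists>C. found C \<and> reaches TM (20 * min (length u) (length v) + 10 - 6 * Suc K) (ZL, (f, m - 1), (g, 1)) C"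
  using assms
proof (induction "length v - K" arbitrary: g K rule: less_induct)
  case less
  let ?n = "min (length u) (length v)"
  from round[OF less.prems(1,2)] show ?case
  proof (elim disjE exE conjE)
    fix C assume "found C" "reaches TM (4 * Suc K) (ZL, (f, m - 1), (g, 1)) C"
    moreover have "4 * Suc K \<le> 20 * ?n + 10 - 6 * Suc K"
    proof -
      have "4 * Suc K + 6 * Suc K = 10 * K + 10" by simp
      also have "\<dots> \<le> 20 * ?n + 10" using mult_le_mono2[OF less.prems(3), of 10] by simp
      finally show ?thesis by (rule add_le_imp_le_diff)
    qed
    ultimately show ?thesis using reaches_mono by blast
  next
    fix g' assume g': "bounded_ruler g' (int (2 * K + 1))" "K < length u" "2 * K + 1 < length v"
      "reaches TM (6 * Suc K) (ZL, (f, m - 1), (g, 1)) (ZL, (f, m - 1), (g', 1))"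
    have n: "2 * K + 1 \<le> 2 * ?n" using g'(2,3) by linarith
    have "length v - (2 * K + 1) < length v - K" using g'(3) by linarith
    from less.hyps[OF this g'(1) disjI2[OF g'(3)] n] obtain C where C: "found C"
      "reaches TM (20 * ?n + 10 - 6 * Suc (2 * K + 1)) (ZL, (f, m - 1), (g', 1)) C"
      by blast
    have "6 * Suc K + (20 * ?n + 10 - 6 * Suc (2 * K + 1)) = 20 * ?n + 10 - 6 * Suc K"
    proof -
      have "6 * Suc K + 6 * Suc K \<le> 20 * ?n + 10" using mult_le_mono2[OF n, of 10] by simp
      moreover have "y + (x - (y + y)) = x - y" if "y + y \<le> x" for x y :: nat using that by simp
      moreover have "6 * Suc (2 * K + 1) = 6 * Suc K + 6 * Suc K" by simp
      ultimately show ?thesis by (simp only:)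
    qed
    then show ?thesis using reaches_trans[OF g'(4) C(2)] C(1) by metis
  qed
qed

end

section \<open>The input tape and the total running time\<close>

lemma input_tape_ahead:
  fixes u v :: "'a list"
  defines "f \<equiv> fst (input_tape u v [])" and "m \<equiv> int (length u) + 1"
  shows "ahead f (m - 1) (-1) (rev u)" "ahead f (m + 1) 1 v" "f m = Sep"
    "ahead f (m - int (length u)) 1 u" "ahead f (m + int (length v)) (-1) (rev v)"
proof -
  have len: "length (input_word u v []) = length u + length v + 4" by (simp add: input_word_def)
  have f: "f (int k) = input_word u v [] ! k" if "k < length u + length v + 4" for k
    using that unfolding f_def input_tape_def len by simp
  have fu: "f (int (Suc k)) = Gen (u ! k)" if "k < length u" for k
    using f[of "Suc k"] that by (simp add: input_word_def nth_append)
  have f0: "f 0 = Sep" using f[of 0] by (simp add: input_word_def)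
  have fm: "f (int (length u + 1)) = Sep" using f[of "length u + 1"] by (simp add: input_word_def nth_append)
  have fv: "f (int (length u + 2 + k)) = Gen (v ! k)" if "k < length v" for k
    using f[of "length u + 2 + k"] that by (simp add: input_word_def nth_append)
  have fe: "f (int (length u + 2 + length v)) = Sep"
    using f[of "length u + 2 + length v"] by (simp add: input_word_def nth_append)
  show "f m = Sep" using fm by (simp add: m_def add.commute)
  show "ahead f (m - 1) (-1) (rev u)"
  proof (rule aheadI)
    fix k assume k: "k < length (rev u)"
    have "m - 1 + -1 * int k = int (Suc (length u - Suc k))" using k by (simp add: m_def)
    then show "f (m - 1 + -1 * int k) = Gen (rev u ! k)"
      using fu[of "length u - Suc k"] k by (simp add: rev_nth)
  qed (use f0 in \<open>simp add: m_def\<close>)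
  show "ahead f (m + 1) 1 v"
  proof (rule aheadI)
    fix k assume k: "k < length v"
    have "m + 1 + 1 * int k = int (length u + 2 + k)" by (simp add: m_def)
    then show "f (m + 1 + 1 * int k) = Gen (v ! k)" by (simp only: fv[OF k])
  next
    have "m + 1 + 1 * int (length v) = int (length u + 2 + length v)" by (simp add: m_def)
    then show "f (m + 1 + 1 * int (length v)) = Sep" by (simp only: fe)
  qed
  show "ahead f (m - int (length u)) 1 u"
  proof (rule aheadI)
    fix k assume k: "k < length u"
    have "m - int (length u) + 1 * int k = int (Suc k)" by (simp add: m_def)
    then show "f (m - int (length u) + 1 * int k) = Gen (u ! k)" using fu[OF k] by simp
  next
    have "m - int (length u) + 1 * int (length u) = int (length u + 1)" by (simp add: m_def)
    then show "f (m - int (length u) + 1 * int (length u)) = Sep" using fm by simp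
  qed
  show "ahead f (m + int (length v)) (-1) (rev v)"
  proof (rule aheadI)
    fix k assume k: "k < length (rev v)"
    have "m + int (length v) + -1 * int k = int (length u + 2 + (length v - Suc k))"
      "rev v ! k = v ! (length v - Suc k)" "length v - Suc k < length v"
      using k by (simp_all add: m_def rev_nth)
    then show "f (m + int (length v) + -1 * int k) = Gen (rev v ! k)"
      by (simp only: fv)
  next
    have "m + int (length v) + -1 * int (length (rev v)) = int (length u + 1)" by (simp add: m_def)
    then show "f (m + int (length v) + -1 * int (length (rev v))) = Sep" using fm by simp
  qed
qed

lemma TM_reaches:
  assumes uv: "u \<in> lists A" "v \<in> lists A"
  defines "n \<equiv> min (length u) (length v)"
  shows "\<exists>t1 t2. reaches TM ((24 + 2 * (c True + c False)) * n + (d True + d False + 8))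
    (initial_config TM u v []) (FIN (E u v), t1, t2)"
proof -
  define f where "f = fst (input_tape u v [])"
  define m where "m = int (length u) + 1"
  note a = input_tape_ahead[of u v, folded f_def m_def]
  let ?g = "(\<lambda>_. Blank)(0 := Sep)"
  have i: "initial_config TM u v [] = (S0, (f, m), (\<lambda>_. Blank, 0))"
    unfolding initial_config_def f_def m_def input_tape_def by simp
  have s: "step TM (initial_config TM u v []) = (ZL, (f, m - 1), (?g, 1))"
    unfolding i by simp
  have "bounded_ruler ?g (int 0)" by (simp add: bounded_ruler_def)
  from zigzag_phase[OF a(1-3) this] obtain C where
    C: "found f u v m C" "reaches TM (20 * n + 10 - 6 * Suc 0) (ZL, (f, m - 1), (?g, 1)) C"
    unfolding n_def by auto
  have "\<exists>t1 t2. reaches TM ((2 + (c True + c False)) * (2 * n) + (d True + d False + 3)) C (FIN (E u v), t1, t2)"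
    using C(1) unfolding found_def[OF a(1-3)]
  proof (elim disjE exE conjE)
    fix g j assume *: "length u \<le> 2 * min (length u) (length v)" "g (j - 1) = Sep"
      "C = (CP True, (f, m - int (length u)), (g, j))"
    obtain t1 t2 where t: "reaches TM ((c True + 2) * length u + d True + 3) C (FIN (P True v u), t1, t2)"
      using compare_phase[OF uv, of f "m - int (length u)" True g j] * a by (auto simp: sg_def)
    have "(c True + 2) * length u \<le> (2 + (c True + c False)) * (2 * n)"
      by (rule mult_le_mono) (use *(1) in \<open>simp_all add: n_def\<close>)
    then have "(c True + 2) * length u + d True + 3 \<le> (2 + (c True + c False)) * (2 * n) + (d True + d False + 3)"
      by linarith
    from reaches_mono[OF t this] show ?thesis unfolding P_True[OF uv] by blast
  next
    fix g j assume *: "length v \<le> 2 * min (length u) (length v)" "g (j + 1) = Sep"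
      "C = (CP False, (f, m + int (length v)), (g, j))"
    have r: "rev v \<in> lists A" "rev u \<in> lists A" using uv by auto
    obtain t1 t2 where t: "reaches TM ((c False + 2) * length (rev v) + d False + 3) C (FIN (P False (rev u) (rev v)), t1, t2)"
      using compare_phase[OF r, of f "m + int (length v)" False g j] * a by (auto simp: sg_def)
    have "(c False + 2) * length (rev v) \<le> (2 + (c True + c False)) * (2 * n)"
      by (rule mult_le_mono) (use *(1) in \<open>simp_all add: n_def\<close>)
    then have "(c False + 2) * length (rev v) + d False + 3 \<le> (2 + (c True + c False)) * (2 * n) + (d True + d False + 3)"
      by linarith
    from reaches_mono[OF t this] show ?thesis unfolding P_False[OF uv] by blast
  qed
  then obtain t1 t2 where
    "reaches TM ((2 + (c True + c False)) * (2 * n) + (d True + d False + 3)) C (FIN (E u v), t1, t2)" by blast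
  \<comment> \<open>One initial step, \<open>20 * n + 4\<close> steps of search, and the comparison
    for a copied word of length at most \<open>2 * n\<close>: the coefficients are
    \<open>20 + 4\<close> and \<open>1 + 4 + 3\<close>.\<close>
  from reaches_step[OF s reaches_trans[OF C(2) this]]
  have "reaches TM ((24 + 2 * (c True + c False)) * n + (d True + d False + 8))
    (initial_config TM u v []) (FIN (E u v), t1, t2)"
    by (rule reaches_mono) (simp add: algebra_simps)
  then show ?thesis by blast
qed

lemma TM_answers:
  assumes "u \<in> lists A" "v \<in> lists A"
  shows "answers_within TM (initial_config TM u v [])
    ((24 + 2 * (c True + c False)) * min (length u) (length v) + (d True + d False + 8)) (E u v)"
  using TM_reaches[OF assms] unfolding reaches_def answers_within_def by fastforce

end

section \<open>Renaming the states\<close>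

text \<open>The states of \<open>TM\<close> contain words over the generators, so their type varies
  with that of the generators; finitely many of them can be numbered.\<close>

definition rename :: "('q \<Rightarrow> nat) \<Rightarrow> ('q, 's) two_tape_tm \<Rightarrow> (nat, 's) two_tape_tm" where
  "rename h M = \<lparr>states = h ` states M, tape_alphabet = tape_alphabet M,
     start = h (start M), accept = h (accept M), reject = h (reject M),
     delta = (\<lambda>n a b. map_prod h id (delta M (inv_into (states M) h n) a b))\<rparr>"

text \<open>The transition function is controlled only on the declared states and symbols, and the
  renaming is invertible only on the declared states, so the simulation has to stay among
  them.\<close>

definition proper_config :: "('q, 's) two_tape_tm \<Rightarrow> ('q, 's) config \<Rightarrow> bool" where
  "proper_config M C \<longleftrightarrow> fst C \<in> states M \<and> range (fst (fst (snd C))) \<subseteq> tape_alphabet M \<and>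
    range (fst (snd (snd C))) \<subseteq> tape_alphabet M"

lemma rename_is_tm:
  assumes M: "is_two_tape_tm M" and h: "inj_on h (states M)"
  shows "is_two_tape_tm (rename h M)"
proof -
  have "h (accept M) \<noteq> h (reject M)" using assms unfolding is_two_tape_tm_def by (metis inj_onD)
  moreover have "map_prod h id (delta M q a b) \<in> h ` states M \<times> (tape_alphabet M \<times> UNIV) \<times> (tape_alphabet M \<times> UNIV)"
    if "q \<in> states M" "a \<in> tape_alphabet M" "b \<in> tape_alphabet M" for q a b
  proof -
    have "delta M q a b \<in> states M \<times> (tape_alphabet M \<times> UNIV) \<times> (tape_alphabet M \<times> UNIV)"
      using M that unfolding is_two_tape_tm_def by blast
    then show ?thesis by (auto simp: mem_Times_iff)
  qed
  ultimately show ?thesis using assms unfolding is_two_tape_tm_def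
    by (simp add: rename_def inv_into_f_f)
qed

lemma rename_step:
  assumes M: "is_two_tape_tm M" and h: "inj_on h (states M)" and C: "proper_config M C"
  shows "proper_config M (step M C) \<and> step (rename h M) (map_prod h id C) = map_prod h id (step M C)"
proof -
  obtain q f i g j where C': "C = (q, (f, i), (g, j))" by (metis surj_pair)
  have q: "q \<in> states M" "range f \<subseteq> tape_alphabet M" "range g \<subseteq> tape_alphabet M"
    using C unfolding C' proper_config_def by auto
  have ar: "accept M \<in> states M" "reject M \<in> states M" using M unfolding is_two_tape_tm_def by auto
  have e: "h q = h (accept M) \<longleftrightarrow> q = accept M" "h q = h (reject M) \<longleftrightarrow> q = reject M"
    using inj_on_eq_iff[OF h] q ar by auto
  obtain q' s1 m1 s2 m2 where d: "delta M q (f i) (g j) = (q', (s1, m1), (s2, m2))" by (metis surj_pair)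
  have "delta M q (f i) (g j) \<in> states M \<times> (tape_alphabet M \<times> UNIV) \<times> (tape_alphabet M \<times> UNIV)"
    using M q unfolding is_two_tape_tm_def by blast
  then have s: "q' \<in> states M" "s1 \<in> tape_alphabet M" "s2 \<in> tape_alphabet M" unfolding d by auto
  have r: "range (f(i := s1)) \<subseteq> tape_alphabet M" "range (g(j := s2)) \<subseteq> tape_alphabet M"
    using q s by auto
  show ?thesis
  proof (cases "q = accept M \<or> q = reject M")
    case True
    then show ?thesis using C e unfolding C' by (auto simp: rename_def)
  next
    case False
    then have "step M C = (q', act (s1, m1) (f, i), act (s2, m2) (g, j))" using d C' by simp
    then show ?thesis using False e d q s r unfolding C'
      by (simp add: proper_config_def rename_def inv_into_f_f[OF h])
  qed
qed

lemma rename_steps: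
  assumes M: "is_two_tape_tm M" and h: "inj_on h (states M)" and C: "proper_config M C"
  shows "proper_config M ((step M ^^ t) C) \<and>
    (step (rename h M) ^^ t) (map_prod h id C) = map_prod h id ((step M ^^ t) C)"
proof (induction t)
  case (Suc t)
  then show ?case using rename_step[OF M h, of "(step M ^^ t) C"]
    by (simp only: funpow.simps o_apply)
qed (use C in simp)

lemma rename_answers:
  assumes "is_two_tape_tm M" "inj_on h (states M)" "proper_config M C" "answers_within M C n b"
  shows "answers_within (rename h M) (map_prod h id C) n b"
  using rename_steps[OF assms(1-3)] assms(4) unfolding answers_within_def rename_def
  by (metis (no_types, lifting) fst_map_prod two_tape_tm.select_convs(4,5))

lemma solves_with_nat_states:
  fixes M :: "('q, 'a tape_symbol) two_tape_tm"
  assumes "solves_word_problem_in_time M A R T"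
  shows "\<exists>M' :: (nat, 'a tape_symbol) two_tape_tm. solves_word_problem_in_time M' A R T"
proof -
  have M: "is_two_tape_tm M" "{Blank, Sep} \<union> Gen ` A \<subseteq> tape_alphabet M"
    using assms unfolding solves_word_problem_in_time_def by auto
  then have "finite (states M)" unfolding is_two_tape_tm_def by blast
  then obtain h :: "'q \<Rightarrow> nat" where h: "inj_on h (states M)"
    using finite_imp_inj_to_nat_seg by metis
  have "proper_config M (initial_config M u v [])" if "u \<in> lists A" "v \<in> lists A" for u v
  proof -
    have "set (input_word u v []) \<subseteq> tape_alphabet M"
      using that M(2) by (auto simp: input_word_def)
    then have "range (fst (input_tape u v [])) \<subseteq> tape_alphabet M"
      using M(2) unfolding input_tape_def by (auto simp: subset_iff intro!: nth_mem)
    then show ?thesis using M unfolding proper_config_def initial_config_def is_two_tape_tm_def by auto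
  qed
  moreover have "initial_config (rename h M) u v [] = map_prod h id (initial_config M u v [])" for u v
    by (simp add: initial_config_def rename_def)
  ultimately have "solves_word_problem_in_time (rename h M) A R T"
    using assms rename_answers[OF M(1) h] rename_is_tm[OF M(1) h]
    unfolding solves_word_problem_in_time_def by (auto simp: rename_def)
  then show ?thesis by blast
qed

theorem theorem1:
  fixes A :: "'a set" and R :: "('a list \<times> 'a list) set"
  assumes "finite_presentation A R" and "small_overlap 4 R"
  shows "\<exists>(M :: (nat, 'a tape_symbol) two_tape_tm) c d.
    solves_word_problem_in_time M A R (\<lambda>u v. c * min (length u) (length v) + d)"
proof -
  obtain Q1 and \<delta>1 :: "('a control, 'a) automaton" and q1 c1 d1 where
    1: "decides A Q1 \<delta>1 verdict_of q1 c1 d1 (\<lambda>u v. (u, v) \<in> presentation_cong A R)"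
    using automaton_decides_word_problem[OF assms] by blast
  obtain Q2 and \<delta>2 :: "('a control, 'a) automaton" and q2 c2 d2 where
    2: "decides A Q2 \<delta>2 verdict_of q2 c2 d2 (\<lambda>u v. (u, v) \<in> presentation_cong A (reversed R))"
    using automaton_decides_word_problem[OF finite_presentation_reversed[OF assms(1)]
      small_overlap_reversed[OF assms(2)]] by blast
  \<comment> \<open>The automaton for \<open>R\<close> reads \<open>v\<close> to the right against
    the copy of \<open>u\<close>, the one for the reversed presentation reads \<open>u\<close> to
    the left against the copy of \<open>v\<close>. Symmetry of the congruence absorbs the exchange
    of arguments in the first case.\<close>
  interpret word_machine A "\<lambda>b. if b then Q1 else Q2" "\<lambda>b. if b then \<delta>1 else \<delta>2" verdict_of
    "\<lambda>b. if b then q1 else q2" "\<lambda>b. if b then c1 else c2" "\<lambda>b. if b then d1 else d2"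
    "\<lambda>b u v. (u, v) \<in> presentation_cong A (if b then R else reversed R)"
    "\<lambda>u v. (u, v) \<in> presentation_cong A R"
  proof
    show "finite A" using assms(1) by (simp add: finite_presentation_def)
    show "decides A (if b then Q1 else Q2) (if b then \<delta>1 else \<delta>2) verdict_of (if b then q1 else q2)
      (if b then c1 else c2) (if b then d1 else d2)
      (\<lambda>u v. (u, v) \<in> presentation_cong A (if b then R else reversed R))" for b
      using 1 2 by (cases b) simp_all
  qed (auto simp: presentation_cong_reversed intro: presentation_cong.sym)
  have eq: "represented_element A R u = represented_element A R v \<longleftrightarrow> (u, v) \<in> presentation_cong A R"
    if "u \<in> lists A" "v \<in> lists A" for u v
    unfolding represented_element_def
    using eq_equiv_class_iff[OF equiv_presentation_cong[OF assms(1)] that] .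
  have "solves_word_problem_in_time TM A R
    (\<lambda>u v. (24 + 2 * (c1 + c2)) * min (length u) (length v) + (d1 + d2 + 8))"
    unfolding solves_word_problem_in_time_def using is_tm TM_answers eq by auto
  then show ?thesis using solves_with_nat_states by blast
qed

end
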